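(* Let $\alpha,\beta\in\mathbb{K}$ satisfy $\alpha+\beta\neq0$, $6\alpha+\beta\neq0$, $16\alpha+\beta\neq0$, and let $\mathfrak{W}$ be the Wahlquist–Estabrook prolongation algebra of the equation $u_t=u_5+(4\alpha-6\beta)u_1u_2+(8\alpha-2\beta)u_0u_3-20\alpha\beta u_0^2u_1$ at a point $a$. Let $\mathfrak{h}$ be the Lie algebra with generators $A_0,A_1,Y$ and relations $[A_1,[A_1,[A_0,A_1]]]=0$, $4\alpha[A_0,A_1]+[A_0,[A_1,[A_0,A_1]]]=0$, $[A_1,[A_1,[A_0,[A_0,[A_0,A_1]]]]]=0$, $[A_1,[A_0,[A_0,[A_0,[A_0,A_1]]]]]-\beta[A_0,[A_0,[A_0,A_1]]]+\frac12[A_0,[A_1,[A_0,[A_0,[A_0,A_1]]]]]=0$, $[A_1,Y]+[A_0,[A_0,[A_0,[A_0,[A_0,A_1]]]]]=0$, $[A_0,Y]=0$. Then $\mathfrak{W}\cong\mathfrak{h}$. Moreover: (1) If $\alpha\neq0$, then $\mathfrak{h}$ is isomorphic to $\mathfrak{sl}_2(\mathbb{K})\oplus\mathbb{K}^3$ (direct sum with the $3$-dimensional abelian Lie algebra), where the summand $\mathfrak{sl}_2(\mathbb{K})$ is the span of $E_1=[A_0,A_1]$, $E_2=[A_0,[A_0,A_1]]$, $E_3=[A_1,[A_0,A_1]]$, and the summand $\mathbb{K}^3$ is the span of $Y$, $Z_0=-4\alpha A_0+[A_0,[A_0,A_1]]$, $Z_1=4\alpha A_1+[A_1,[A_0,A_1]]$.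 (2) If $\alpha=0$, then $\mathfrak{h}$ is nilpotent and $\dim\mathfrak{h}\le6$.
   Context: $\mathbb{K}$ is $\mathbb{C}$ or $\mathbb{R}$; Lie algebras are over $\mathbb{K}$. For an evolution equation $u_t=F(u_0,\dots,u_5)$ (with $u_k=\partial^ku/\partial x^k$, $F$ independent of $x,t$) and a point $a$ with coordinates $u_k=a_k$, the Wahlquist–Estabrook prolongation algebra is the Lie algebra with generators $\mathcal{A}_i$ ($i\ge0$) and $\mathcal{B}_{j_0\dots j_4}$ ($j_0,\dots,j_4\ge0$), subject to the relations obtained by requiring that all coefficients vanish in the formal power series identity $\sum_{k=0}^4u_{k+1}\frac{\partial\mathcal{B}}{\partial u_k}-F\,\frac{\partial\mathcal{A}}{\partial u_0}+[\mathcal{A},\mathcal{B}]=0$, where $\mathcal{A}=\sum_i(u_0-a_0)^i\mathcal{A}_i$, $\mathcal{B}=\sum\prod_{r=0}^4(u_r-a_r)^{j_r}\mathcal{B}_{j_0\dots j_4}$, polynomials in the $u_k$ are expanded in powers of $u_k-a_k$, and brackets are computed coefficientwise. *)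

theory Defs
  imports "HOL-Analysis.Finite_Cartesian_Product"
begin

definition is_R_or_C :: "'k::field itself \<Rightarrow> bool" where
  "is_R_or_C _ \<longleftrightarrow>
     (\<exists>\<phi>::'k \<Rightarrow> real. bij \<phi> \<and> \<phi> 1 = 1 \<and> (\<forall>x y. \<phi> (x + y) = \<phi> x + \<phi> y) \<and> (\<forall>x y. \<phi> (x * y) = \<phi> x * \<phi> y))
   \<or> (\<exists>\<phi>::'k \<Rightarrow> complex. bij \<phi> \<and> \<phi> 1 = 1 \<and> (\<forall>x y. \<phi> (x + y) = \<phi> x + \<phi> y) \<and> (\<forall>x y. \<phi> (x * y) = \<phi> x * \<phi> y))"

section \<open>Free associative algebra K<G> (noncommutative polynomials: word \<Rightarrow> coefficient)\<close>

type_synonym ('g, 'k) fa = "'g list \<Rightarrow> 'k"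

definition fa_zero :: "('g, 'k::field) fa" where "fa_zero = (\<lambda>w. 0)"
definition fa_add :: "('g, 'k::field) fa \<Rightarrow> ('g, 'k) fa \<Rightarrow> ('g, 'k) fa" where
  "fa_add p q = (\<lambda>w. p w + q w)"
definition fa_smult :: "'k::field \<Rightarrow> ('g, 'k) fa \<Rightarrow> ('g, 'k) fa" where
  "fa_smult c p = (\<lambda>w. c * p w)"
definition fa_diff :: "('g, 'k::field) fa \<Rightarrow> ('g, 'k) fa \<Rightarrow> ('g, 'k) fa" where
  "fa_diff p q = (\<lambda>w. p w - q w)"
definition fa_sum :: "('i \<Rightarrow> ('g, 'k::field) fa) \<Rightarrow> 'i set \<Rightarrow> ('g, 'k) fa" where
  "fa_sum f A = (\<lambda>w. \<Sum>i\<in>A. f i w)"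
definition fa_mult :: "('g, 'k::field) fa \<Rightarrow> ('g, 'k) fa \<Rightarrow> ('g, 'k) fa" where
  "fa_mult p q = (\<lambda>w. \<Sum>i\<le>length w. p (take i w) * q (drop i w))"
definition fa_gen :: "'g \<Rightarrow> ('g, 'k::field) fa" where
  "fa_gen x = (\<lambda>w. if w = [x] then 1 else 0)"
definition fa_br :: "('g, 'k::field) fa \<Rightarrow> ('g, 'k) fa \<Rightarrow> ('g, 'k) fa" where
  "fa_br p q = fa_diff (fa_mult p q) (fa_mult q p)"

inductive_set free_lie :: "('g, 'k::field) fa set" where
  fl_gen: "fa_gen x \<in> free_lie"
| fl_zero: "fa_zero \<in> free_lie"
| fl_add: "p \<in> free_lie \<Longrightarrow> q \<in> free_lie \<Longrightarrow> fa_add p q \<in> free_lie"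
| fl_smult: "p \<in> free_lie \<Longrightarrow> fa_smult c p \<in> free_lie"
| fl_br: "p \<in> free_lie \<Longrightarrow> q \<in> free_lie \<Longrightarrow> fa_br p q \<in> free_lie"

inductive_set lie_ideal :: "('g, 'k::field) fa set \<Rightarrow> ('g, 'k) fa set" for R where
  li_rel: "r \<in> R \<Longrightarrow> r \<in> lie_ideal R"
| li_zero: "fa_zero \<in> lie_ideal R"
| li_add: "p \<in> lie_ideal R \<Longrightarrow> q \<in> lie_ideal R \<Longrightarrow> fa_add p q \<in> lie_ideal R"
| li_smult: "p \<in> lie_ideal R \<Longrightarrow> fa_smult c p \<in> lie_ideal R"
| li_br: "p \<in> lie_ideal R \<Longrightarrow> q \<in> free_lie \<Longrightarrow> fa_br q p \<in> lie_ideal R"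

text \<open>The Lie algebra presented by generators G and relations R is free_lie / lie_ideal R.
  An isomorphism of two presented Lie algebras, written out on representatives.\<close>
definition pres_iso :: "('g1, 'k::field) fa set \<Rightarrow> ('g2, 'k) fa set \<Rightarrow> bool" where
  "pres_iso R1 R2 \<longleftrightarrow> (\<exists>f :: ('g1, 'k) fa \<Rightarrow> ('g2, 'k) fa.
     (\<forall>x\<in>free_lie. f x \<in> free_lie)
   \<and> (\<forall>x\<in>free_lie. \<forall>y\<in>free_lie. fa_diff (f (fa_add x y)) (fa_add (f x) (f y)) \<in> lie_ideal R2)
   \<and> (\<forall>c. \<forall>x\<in>free_lie. fa_diff (f (fa_smult c x)) (fa_smult c (f x)) \<in> lie_ideal R2)
   \<and> (\<forall>x\<in>free_lie. \<forall>y\<in>free_lie. fa_diff (f (fa_br x y)) (fa_br (f x) (f y)) \<in> lie_ideal R2)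
   \<and> (\<forall>x\<in>free_lie. f x \<in> lie_ideal R2 \<longleftrightarrow> x \<in> lie_ideal R1)
   \<and> (\<forall>y\<in>free_lie. \<exists>x\<in>free_lie. fa_diff (f x) y \<in> lie_ideal R2))"

definition fa_span :: "('g, 'k::field) fa list \<Rightarrow> ('g, 'k) fa set" where
  "fa_span L = {fa_sum (\<lambda>i. fa_smult (c i) (L ! i)) {..<length L} | c. True}"

definition pres_dim_le :: "('g, 'k::field) fa set \<Rightarrow> nat \<Rightarrow> bool" where
  "pres_dim_le R n \<longleftrightarrow> (\<exists>L. length L \<le> n \<and> set L \<subseteq> free_lie \<and>
      (\<forall>x\<in>free_lie. \<exists>y\<in>fa_span L. fa_diff x y \<in> lie_ideal R))"

inductive_set fa_lspan :: "('g, 'k::field) fa set \<Rightarrow> ('g, 'k) fa set" for S where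
  ls_base: "x \<in> S \<Longrightarrow> x \<in> fa_lspan S"
| ls_zero: "fa_zero \<in> fa_lspan S"
| ls_add: "p \<in> fa_lspan S \<Longrightarrow> q \<in> fa_lspan S \<Longrightarrow> fa_add p q \<in> fa_lspan S"
| ls_smult: "p \<in> fa_lspan S \<Longrightarrow> fa_smult c p \<in> fa_lspan S"

fun lcs :: "nat \<Rightarrow> ('g, 'k::field) fa set" where
  "lcs 0 = free_lie"
| "lcs (Suc n) = fa_lspan {fa_br x y | x y. x \<in> free_lie \<and> y \<in> lcs n}"

text \<open>free_lie / lie_ideal R is nilpotent: its lower central series
  (the image of that of free_lie) eventually vanishes\<close>
definition pres_nilpotent :: "('g, 'k::field) fa set \<Rightarrow> bool" where
  "pres_nilpotent R \<longleftrightarrow> (\<exists>n. lcs n \<subseteq> lie_ideal R)"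

type_synonym 'k tgt = "('k ^ 2 ^ 2) \<times> ('k ^ 3)"

definition tgt_carrier :: "'k::field tgt set" where
  "tgt_carrier = {(M, v). M $ 1 $ 1 + M $ 2 $ 2 = 0}"
definition tgt_add :: "'k::field tgt \<Rightarrow> 'k tgt \<Rightarrow> 'k tgt" where
  "tgt_add x y = (fst x + fst y, snd x + snd y)"
definition tgt_smult :: "'k::field \<Rightarrow> 'k tgt \<Rightarrow> 'k tgt" where
  "tgt_smult c x = ((\<chi> i j. c * fst x $ i $ j), (\<chi> i. c * snd x $ i))"
definition tgt_br :: "'k::field tgt \<Rightarrow> 'k tgt \<Rightarrow> 'k tgt" where
  "tgt_br x y = (fst x ** fst y - fst y ** fst x, 0)"

definition iso_to_tgt :: "('g, 'k::field) fa set \<Rightarrow> (('g, 'k) fa \<Rightarrow> 'k tgt) \<Rightarrow> bool" where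
  "iso_to_tgt R \<Phi> \<longleftrightarrow>
     \<Phi> ` free_lie = tgt_carrier
   \<and> (\<forall>x\<in>free_lie. \<forall>y\<in>free_lie. \<Phi> (fa_add x y) = tgt_add (\<Phi> x) (\<Phi> y))
   \<and> (\<forall>c. \<forall>x\<in>free_lie. \<Phi> (fa_smult c x) = tgt_smult c (\<Phi> x))
   \<and> (\<forall>x\<in>free_lie. \<forall>y\<in>free_lie. \<Phi> (fa_br x y) = tgt_br (\<Phi> x) (\<Phi> y))
   \<and> (\<forall>x\<in>free_lie. \<Phi> x = (0, 0) \<longleftrightarrow> x \<in> lie_ideal R)"

datatype wgen = WA nat | WB nat nat nat nat nat

text \<open>Multi-indices m for monomials \<Prod>_{r=0..5} (u_r - a_r)^(m r).
  A polynomial F in u_0..u_5 is given by a list of monomials (c, e) meaning c * \<Prod>_{r<6} u_r^(e r).\<close>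

definition taylor_coeff :: "('k::field \<times> (nat \<Rightarrow> nat)) list \<Rightarrow> (nat \<Rightarrow> 'k) \<Rightarrow> (nat \<Rightarrow> nat) \<Rightarrow> 'k" where
  "taylor_coeff F a n = (\<Sum>(c, e)\<leftarrow>F. c * (\<Prod>r<6. of_nat (e r choose n r) * a r ^ (e r - n r)))"

definition WA' :: "nat \<Rightarrow> (wgen, 'k::field) fa" where "WA' i = fa_gen (WA i)"
definition WB' :: "(nat \<Rightarrow> nat) \<Rightarrow> (wgen, 'k::field) fa" where
  "WB' m = fa_gen (WB (m 0) (m 1) (m 2) (m 3) (m 4))"

text \<open>coefficient of x^m in dB/du_k (x_r = u_r - a_r)\<close>
definition dB :: "nat \<Rightarrow> (nat \<Rightarrow> nat) \<Rightarrow> (wgen, 'k::field) fa" where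
  "dB k m = (if m 5 = 0 then fa_smult (of_nat (m k + 1)) (WB' (m(k := m k + 1))) else fa_zero)"

text \<open>coefficient of x^m in  \<Sum>_{k=0..4} u_{k+1} dB/du_k - F dA/du_0 + [A,B]\<close>
definition WE_coeff :: "('k::field \<times> (nat \<Rightarrow> nat)) list \<Rightarrow> (nat \<Rightarrow> 'k) \<Rightarrow> (nat \<Rightarrow> nat) \<Rightarrow> (wgen, 'k) fa" where
  "WE_coeff F a m =
     fa_add
      (fa_diff
        (fa_sum (\<lambda>k. fa_add (fa_smult (a (k + 1)) (dB k m))
                            (if 1 \<le> m (k + 1) then dB k (m(k + 1 := m (k + 1) - 1)) else fa_zero)) {..<5})
        (fa_sum (\<lambda>i. fa_smult (taylor_coeff F a (m(0 := m 0 - i)) * of_nat (i + 1)) (WA' (i + 1))) {..m 0}))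
      (if m 5 = 0 then fa_sum (\<lambda>i. fa_br (WA' i) (WB' (m(0 := m 0 - i)))) {..m 0} else fa_zero)"

definition WE_rels :: "('k::field \<times> (nat \<Rightarrow> nat)) list \<Rightarrow> (nat \<Rightarrow> 'k) \<Rightarrow> (wgen, 'k) fa set" where
  "WE_rels F a = {WE_coeff F a m | m. \<forall>r\<ge>6. m r = 0}"

definition F_eq :: "'k::field \<Rightarrow> 'k \<Rightarrow> ('k \<times> (nat \<Rightarrow> nat)) list" where
  "F_eq \<alpha> \<beta> =
    [(1, \<lambda>r. if r = 5 then 1 else 0),
     (4 * \<alpha> - 6 * \<beta>, \<lambda>r. if r = 1 \<or> r = 2 then 1 else 0),
     (8 * \<alpha> - 2 * \<beta>, \<lambda>r. if r = 0 \<or> r = 3 then 1 else 0),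
     (- 20 * \<alpha> * \<beta>, \<lambda>r. if r = 0 then 2 else if r = 1 then 1 else 0)]"

datatype hgen = HA0 | HA1 | HY

definition hA0 :: "(hgen, 'k::field) fa" where "hA0 = fa_gen HA0"
definition hA1 :: "(hgen, 'k::field) fa" where "hA1 = fa_gen HA1"
definition hY :: "(hgen, 'k::field) fa" where "hY = fa_gen HY"

definition h_rels :: "'k::field \<Rightarrow> 'k \<Rightarrow> (hgen, 'k) fa set" where
  "h_rels \<alpha> \<beta> = {
     fa_br hA1 (fa_br hA1 (fa_br hA0 hA1)),
     fa_add (fa_smult (4 * \<alpha>) (fa_br hA0 hA1)) (fa_br hA0 (fa_br hA1 (fa_br hA0 hA1))),
     fa_br hA1 (fa_br hA1 (fa_br hA0 (fa_br hA0 (fa_br hA0 hA1)))),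
     fa_add (fa_diff (fa_br hA1 (fa_br hA0 (fa_br hA0 (fa_br hA0 (fa_br hA0 hA1)))))
                     (fa_smult \<beta> (fa_br hA0 (fa_br hA0 (fa_br hA0 hA1)))))
            (fa_smult (1/2) (fa_br hA0 (fa_br hA1 (fa_br hA0 (fa_br hA0 (fa_br hA0 hA1)))))),
     fa_add (fa_br hA1 hY) (fa_br hA0 (fa_br hA0 (fa_br hA0 (fa_br hA0 (fa_br hA0 hA1))))),
     fa_br hA0 hY }"

end

theory Submission
  imports Defs "HOL-Library.Function_Algebras" "HOL-Analysis.Cartesian_Space"
begin

text \<open>
  Write the defining identity as an equation between formal power series in \<open>x\<^sub>k = u\<^sub>k - a\<^sub>k\<close> with
  coefficients in the Lie algebra. Differentiating it successively in \<open>u\<^sub>5, u\<^sub>4, \<dots>, u\<^sub>1\<close> expresses all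
  partial derivatives of \<open>B\<close> through \<open>A\<close>, and compatibility of mixed derivatives forces the third
  derivative of \<open>A\<close> to vanish and then, because \<open>6 \<alpha> + \<beta> \<noteq> 0\<close>, also the second. So \<open>A = A\<^sub>0 + u\<^sub>0 A\<^sub>1\<close>, \<open>B\<close> is a polynomial in the \<open>u\<^sub>k\<close> up to one
  constant \<open>Y\<close>, and what remains of the identity is exactly the list of relations of \<open>h\<close>. Re-expansion of this
  polynomial about \<open>a\<close> gives mutually inverse maps between the two presentations; they are restrictions of
  substitution homomorphisms of free associative algebras.

  In \<open>h\<close> the element \<open>Z\<^sub>1\<close> commutes with \<open>A\<^sub>0\<close> and \<open>A\<^sub>1\<close>, hence with \<open>[A\<^sub>1, Y]\<close>. Evaluating
  \<open>[A\<^sub>1, [Z\<^sub>1, Y]] = 0\<close> yields \<open>(6 \<alpha> + \<beta>) (16 \<alpha> + \<beta>) (\<alpha> + \<beta>) [A\<^sub>0, [A\<^sub>0, [A\<^sub>0, A\<^sub>1]]] = 0\<close>, after which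
  \<open>h\<close> is spanned by \<open>A\<^sub>0, A\<^sub>1, Y, E\<^sub>1, E\<^sub>2, E\<^sub>3\<close> with explicit brackets.
\<close>

section \<open>Lie algebra structures on function spaces\<close>

text \<open>The three nonvanishing conditions enter one at a time. The eigenvalue \<open>lam\<close>
  of \<open>br E\<close> on \<open>e3\<close> is a multiple of 6\<alpha>+\<beta>; dividing by it
  yields \<open>br e2 e3 = sc lam e4\<close>. Applying \<open>br A1\<close> to this leaves
  \<open>(4 * \<alpha> - lam) * nu\<close> times \<open>e3\<close>, whose two factors are multiples
  of 16\<alpha>+\<beta> and \<alpha>+\<beta>. The first condition occurs once more as 2 c2 - c1 = 2
  (6\<alpha>+\<beta>), where the quadratic term of A is removed. The formal obstacle is that a
  presented Lie algebra is given only as a set modulo an ideal, whereas the calculations need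
  equations. Each quotient is therefore realized as a bracket on the function space that carries the
  free algebra, so that free algebras and quotients are instances of one locale. Independence of the
  six spanning elements of h for \<alpha> \<noteq> 0 comes from an explicit map to matrices and
  vectors.\<close>

definition sc :: "'k::field \<Rightarrow> ('i \<Rightarrow> 'k) \<Rightarrow> 'i \<Rightarrow> 'k" where
  "sc c x = (\<lambda>w. c * x w)"

lemma sc_apply: "sc c x w = c * x w" by (simp add: sc_def)

interpretation sc: vector_space sc
  by unfold_locales (auto simp: sc_def fun_eq_iff algebra_simps)

locale lie_alg =
  fixes br :: "('i \<Rightarrow> 'k::field_char_0) \<Rightarrow> ('i \<Rightarrow> 'k) \<Rightarrow> ('i \<Rightarrow> 'k)"
  assumes br_add_left: "br (x + y) z = br x z + br y z"
    and br_add_right: "br z (x + y) = br z x + br z y"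
    and br_sc_left: "br (sc c x) z = sc c (br x z)"
    and br_sc_right: "br z (sc c x) = sc c (br z x)"
    and br_self: "br x x = 0"
    and jacobi: "br x (br y z) = br (br x y) z + br y (br x z)"
begin

lemma br_zero_left: "br 0 z = 0"
  using br_sc_left[of 0 0 z] by simp

lemma br_zero_right: "br z 0 = 0"
  using br_sc_right[of z 0 0] by simp

lemma br_minus_left: "br (- x) z = - br x z"
  using br_sc_left[of "-1" x z] by simp

lemma br_minus_right: "br z (- x) = - br z x"
  using br_sc_right[of z "-1" x] by simp

lemma br_diff_left: "br (x - y) z = br x z - br y z"
  using br_add_left[of x "-y" z] by (simp add: br_minus_left)

lemma br_diff_right: "br z (x - y) = br z x - br z y"
  using br_add_right[of z x "-y"] by (simp add: br_minus_right)

lemma br_anti: "br x y = - br y x"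
proof -
  have "br (x + y) (x + y) = br x y + br y x"
    by (simp only: br_add_left br_add_right) (simp add: br_self)
  then have "br x y + br y x = 0" by (simp only: br_self)
  then show ?thesis by (rule eq_neg_iff_add_eq_0[THEN iffD2])
qed

lemmas br_linear = br_add_left br_add_right br_sc_left br_sc_right br_zero_left br_zero_right
  br_minus_left br_minus_right br_diff_left br_diff_right

lemma jacobi_left: "br (br x y) z = br x (br y z) - br y (br x z)"
  using jacobi[of x y z] by (simp add: algebra_simps)

end

text \<open>Evaluating a vector equation at an index turns it into an equation in the field, where
  \<open>algebra_simps\<close> and \<open>algebra\<close> can do the linear bookkeeping.\<close>

lemmas pointwise = fun_eq_iff sc_apply plus_fun_apply minus_apply uminus_apply zero_fun_apply

section \<open>Consequences of the relations of h\<close>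

locale h_alg = lie_alg br for br :: "('i \<Rightarrow> 'k::field_char_0) \<Rightarrow> ('i \<Rightarrow> 'k) \<Rightarrow> ('i \<Rightarrow> 'k)" +
  fixes \<alpha> \<beta> :: 'k and A0 A1 Y :: "'i \<Rightarrow> 'k"
  assumes nz1: "\<alpha> + \<beta> \<noteq> 0" and nz2: "6 * \<alpha> + \<beta> \<noteq> 0" and nz3: "16 * \<alpha> + \<beta> \<noteq> 0"
    and r1: "br A1 (br A1 (br A0 A1)) = 0"
    and r2: "sc (4 * \<alpha>) (br A0 A1) + br A0 (br A1 (br A0 A1)) = 0"
    and r3: "br A1 (br A1 (br A0 (br A0 (br A0 A1)))) = 0"
    and r4: "br A1 (br A0 (br A0 (br A0 (br A0 A1)))) - sc \<beta> (br A0 (br A0 (br A0 A1)))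
              + sc (1/2) (br A0 (br A1 (br A0 (br A0 (br A0 A1))))) = 0"
    and r5: "br A1 Y + br A0 (br A0 (br A0 (br A0 (br A0 A1)))) = 0"
    and r6: "br A0 Y = 0"
begin

definition "E = br A0 A1"
definition "e2 = br A0 E"
definition "E3 = br A1 E"

lemma A0_A1: "br A0 A1 = E" and A0_E: "br A0 E = e2" and A1_E: "br A1 E = E3"
  by (simp_all add: E_def e2_def E3_def)

lemma A1_E3: "br A1 E3 = 0"
  using r1 by (simp add: A0_A1 A1_E)

lemma A0_E3: "br A0 E3 = sc (- 4 * \<alpha>) E"
  using r2 by (simp add: A0_A1 A1_E add_eq_0_iff)

lemma E_bracket: "br E x = br A0 (br A1 x) - br A1 (br A0 x)"
  by (simp add: E_def jacobi_left)

lemma e2_bracket: "br e2 x = br A0 (br E x) - br E (br A0 x)"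
  by (simp add: e2_def jacobi_left)

lemma E3_bracket: "br E3 x = br A1 (br E x) - br E (br A1 x)"
  by (simp add: E3_def jacobi_left)

text \<open>From [E, E] = 0: the operators \<open>br A0\<close> and \<open>br A1\<close> may be
  interchanged in front of \<open>E\<close>, so this bracket equals \<open>br A0 E3\<close>.\<close>

lemma A1_e2: "br A1 e2 = sc (- 4 * \<alpha>) E"
  using E_bracket[of E] by (simp add: br_self A1_E A0_E A0_E3)

lemma E_E3: "br E E3 = sc (4 * \<alpha>) E3"
  by (simp add: E_bracket A1_E3 A0_E3 br_linear A1_E)

lemma E3_e2: "br E3 e2 = sc (16 * \<alpha>\<^sup>2) E"
proof -
  have "br e2 E3 = sc (- (16 * \<alpha>\<^sup>2)) E"
    by (simp add: e2_bracket E_E3 br_linear A0_E3 br_self) (simp add: power2_eq_square)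
  then show ?thesis using br_anti[of E3 e2] by simp
qed

definition "e3 = br A0 e2"
definition "X = br A1 e3"

lemma A0_e2: "br A0 e2 = e3" and A1_e3: "br A1 e3 = X"
  by (simp_all add: e3_def X_def)

text \<open>The relations make \<^term>\<open>e3\<close> an eigenvector of \<^term>\<open>br E\<close> with eigenvalue \<open>lam\<close>.\<close>
definition "lam = - (2/5) * (6 * \<alpha> + \<beta>)"
abbreviation "mu \<equiv> - lam - 4 * \<alpha>"
abbreviation "nu \<equiv> - 2 * lam - 4 * \<alpha>"

lemma E_e2: "br E e2 = sc (- 4 * \<alpha>) e2 - X"
  by (simp add: E_bracket A1_e2 A0_e2 br_linear A0_E A1_e3)

text \<open>\<open>br A0\<close> is a derivation; applying it to \<open>E_e2\<close> gives the
  bracket of \<open>E\<close> with the next element, and the cross term \<open>br e2 e2\<close>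
  vanishes. The brackets of \<open>E\<close> with \<open>e4\<close> and \<open>e5\<close> arise in
  the same way.\<close>

lemma E_e3_aux: "br E e3 = sc (- 4 * \<alpha>) e3 - br A0 X"
proof -
  have "br A0 (br E e2) = br e2 e2 + br E (br A0 e2)"
    by (subst jacobi) (simp add: A0_E)
  then show ?thesis by (simp add: br_self E_e2 A0_e2 br_linear)
qed

text \<open>Two values of \<open>br E e3\<close>, from \<open>E_e3_aux\<close> and from
  \<open>E_bracket\<close>, together with the relation \<open>r4\<close> form a linear system for
  \<open>br A0 X\<close> and \<open>br A1 (br A0 e3)\<close>. Its solution has denominator 5, which
  is where the 2/5 in \<open>lam\<close> comes from.\<close>

lemma A0_X: "br A0 X = sc mu e3" and A1_e4: "br A1 (br A0 e3) = sc nu e3"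
proof -
  have r4': "br A1 (br A0 e3) - sc \<beta> e3 + sc (1/2) (br A0 X) = 0"
    using r4 by (simp add: A0_A1 A0_E A0_e2 A1_e3)
  have "sc (- 4 * \<alpha>) e3 - br A0 X = br A0 X - br A1 (br A0 e3)"
    using E_e3_aux by (simp add: E_bracket A1_e3)
  note eqs = this r4'
  show "br A0 X = sc mu e3"
  proof
    fix w show "br A0 X w = sc mu e3 w"
      using eqs[THEN fun_cong, of w] by (simp add: pointwise lam_def field_simps)
  qed
  show "br A1 (br A0 e3) = sc nu e3"
  proof
    fix w show "br A1 (br A0 e3) w = sc nu e3 w"
      using eqs[THEN fun_cong, of w] by (simp add: pointwise lam_def field_simps) algebra
  qed
qed

lemma E_e3: "br E e3 = sc lam e3"
  by (simp add: E_e3_aux A0_X) (simp add: pointwise algebra_simps)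

lemma A1_X: "br A1 X = 0"
  using r3 by (simp add: A0_A1 A0_E A0_e2 A1_e3)

lemma E_X: "br E X = sc (- mu) X"
  by (simp add: E_bracket A0_X A1_X br_linear A1_e3) (simp add: pointwise algebra_simps)

lemma e2_X: "br e2 X = sc (4 * \<alpha> * mu) e3"
  by (simp add: e2_bracket E_X A0_X br_linear E_e3) (simp add: pointwise algebra_simps)

lemma A1_e2_e3: "br A1 (br e2 e3) = sc (4 * \<alpha> * nu) e3"
  by (subst jacobi) (simp add: A1_e2 A1_e3 br_linear E_e3 e2_X, simp add: pointwise algebra_simps)

definition "e4 = br A0 e3"
definition "e5 = br A0 e4"

lemma A0_e3: "br A0 e3 = e4" and A0_e4: "br A0 e4 = e5"
  by (simp_all add: e4_def e5_def)

lemma A1_e4': "br A1 e4 = sc nu e3"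
  by (simp add: e4_def A1_e4)

lemma E_e4: "br E e4 = sc lam e4 - br e2 e3"
proof -
  have "br A0 (br E e3) = br e2 e3 + br E e4"
    by (subst jacobi) (simp add: A0_E A0_e3)
  then show ?thesis by (simp add: E_e3 br_linear A0_e3)
qed

text \<open>\<open>E_bracket\<close> read backwards: \<open>br A1 (br A0 x)\<close> is
  \<open>br A0 (br A1 x) - br E x\<close>.\<close>

lemma A1_e5: "br A1 e5 = sc (nu - lam) e4 + br e2 e3"
  using E_bracket[of e4]
  by (simp add: E_e4 A0_e4 A1_e4' br_linear A0_e3) (simp add: pointwise algebra_simps)

lemma A0_e2_e3: "br A0 (br e2 e3) = br e2 e4"
  by (subst jacobi) (simp add: A0_e2 A0_e3 br_self)

lemma E_e5: "br E e5 = sc lam e5 - sc 2 (br e2 e4)"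
proof -
  have "br A0 (br E e4) = br e2 e4 + br E e5"
    by (subst jacobi) (simp add: A0_E A0_e4)
  then show ?thesis by (simp add: E_e4 br_linear A0_e4 A0_e2_e3) (simp add: pointwise algebra_simps)
qed

lemma A1_e6: "br A1 (br A0 e5) = sc (nu - 2 * lam) e5 + sc 3 (br e2 e4)"
  using E_bracket[of e5]
  by (simp add: E_e5 A1_e5 br_linear A0_e4 A0_e2_e3) (simp add: pointwise algebra_simps)

lemma A1_Y_e5: "br A1 Y = - e5"
  using r5 by (simp add: A0_A1 A0_E A0_e2 A0_e3 A0_e4 eq_neg_iff_add_eq_0)

text \<open>Expand \<open>E3\<close> into \<open>A1\<close> and \<open>E\<close>, then
  \<open>E\<close> into \<open>A0\<close> and \<open>A1\<close>. Since \<open>Y\<close> commutes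
  with \<open>A0\<close> and \<open>br A1 Y\<close> is \<open>- e5\<close>, only brackets with
  \<open>e5\<close> remain.\<close>

lemma E3_Y: "br E3 Y = sc (3 * lam - nu) e5 - sc 5 (br e2 e4)"
  by (simp add: E3_bracket E_bracket[of Y] r6 A1_Y_e5 br_linear A1_e6 E_e5)
    (simp add: pointwise algebra_simps)

text \<open>The element \<^term>\<open>Z1\<close> below commutes with \<^term>\<open>A0\<close> and \<^term>\<open>A1\<close>, hence with the
  subalgebra generated by them, which contains \<^term>\<open>br A1 Y\<close>. So \<^term>\<open>br A1 (br Z1 Y)\<close> vanishes.\<close>

definition "Z1 = sc (4 * \<alpha>) A1 + E3"

lemma A0_Z1: "br A0 Z1 = 0" and A1_Z1: "br A1 Z1 = 0"
  by (simp_all add: Z1_def br_linear A0_A1 A0_E3 A1_E3 br_self)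

lemma Z1_commutes: "br Z1 (br A0 x) = br A0 (br Z1 x)" "br Z1 (br A1 x) = br A1 (br Z1 x)"
  using jacobi[of Z1 A0 x] jacobi[of Z1 A1 x] br_anti[of Z1 A0] br_anti[of Z1 A1]
  by (simp_all add: A0_Z1 A1_Z1 br_linear)

lemma Z1_e5: "br Z1 e5 = 0"
  using br_anti[of Z1 A1] A1_Z1
  by (simp add: e5_def e4_def e3_def e2_def E_def Z1_commutes br_linear)

text \<open>Since \<open>nu + 4 * \<alpha> = - 2 * lam\<close>, the vanishing of
  \<open>br A1 (br Z1 Y)\<close> collapses to \<open>15 * lam\<close> times the difference of both
  sides, and \<open>lam\<close> is nonzero by \<open>nz2\<close>.\<close>

lemma e2_e3: "br e2 e3 = sc lam e4"
proof -
  have "br A1 (br Z1 Y) = 0"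
    using Z1_commutes(2)[of Y] by (simp add: A1_Y_e5 br_linear Z1_e5)
  moreover have "br Z1 Y = sc 5 (sc lam e5 - br e2 e4)"
    by (simp add: Z1_def br_linear A1_Y_e5 E3_Y) (simp add: pointwise algebra_simps)
  moreover have "br A1 (br e2 e4) = sc (- 4 * \<alpha> * lam) e4 + sc (4 * \<alpha> + nu) (br e2 e3)"
    by (subst jacobi) (simp add: A1_e2 A1_e4' br_linear E_e4, simp add: pointwise algebra_simps)
  ultimately have "sc (15 * lam) (br e2 e3 - sc lam e4) = 0"
    by (simp add: br_linear A1_e5) (simp add: pointwise algebra_simps)
  moreover have "lam \<noteq> 0" using nz2 unfolding lam_def by (intro no_zero_divisors) simp_all
  ultimately show ?thesis by simp
qed

text \<open>Bracketing \<open>e2_e3\<close> with \<open>A1\<close> gives \<open>lam * nu\<close>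
  times \<open>e3\<close>, whereas \<open>A1_e2_e3\<close> gives \<open>4 * \<alpha> * nu\<close>
  times \<open>e3\<close>. The difference of these scalars is nonzero by \<open>nz1\<close> and
  \<open>nz3\<close>.\<close>

lemma e3_zero: "e3 = 0"
proof -
  have "sc (4 * \<alpha> * nu) e3 = sc (lam * nu) e3"
    using A1_e2_e3 by (auto simp: e2_e3 br_linear A1_e4')
  then have "sc ((4 * \<alpha> - lam) * nu) e3 = 0"
    by (simp only: left_diff_distrib[of "4 * \<alpha>" lam] sc.scale_left_diff_distrib right_minus_eq)
  moreover have f: "4 * \<alpha> - lam = (2/5) * (16 * \<alpha> + \<beta>)" "nu = (4/5) * (\<alpha> + \<beta>)"
    by (simp_all add: lam_def field_simps)
  have "(4 * \<alpha> - lam) * nu \<noteq> 0" unfolding f using nz1 nz3 by (intro no_zero_divisors) simp_all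
  ultimately show ?thesis using sc.scale_eq_0_iff by blast
qed

lemma X_zero: "X = 0"
  by (simp add: X_def e3_zero br_linear)

text \<open>The full multiplication table of the six spanning elements, in both orders so that
  simplification can evaluate any bracket of linear combinations.\<close>

lemma brackets:
  "br A0 A1 = E" "br A1 A0 = - E" "br A0 E = e2" "br E A0 = - e2" "br A1 E = E3" "br E A1 = - E3"
  "br A0 e2 = 0" "br e2 A0 = 0" "br A1 e2 = sc (- 4 * \<alpha>) E" "br e2 A1 = sc (4 * \<alpha>) E"
  "br A0 E3 = sc (- 4 * \<alpha>) E" "br E3 A0 = sc (4 * \<alpha>) E" "br A1 E3 = 0" "br E3 A1 = 0"
  "br E e2 = sc (- 4 * \<alpha>) e2" "br e2 E = sc (4 * \<alpha>) e2"
  "br E E3 = sc (4 * \<alpha>) E3" "br E3 E = sc (- 4 * \<alpha>) E3"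
  "br E3 e2 = sc (16 * \<alpha>\<^sup>2) E" "br e2 E3 = sc (- 16 * \<alpha>\<^sup>2) E"
  "br A0 Y = 0" "br Y A0 = 0" "br A1 Y = 0" "br Y A1 = 0" "br E Y = 0" "br Y E = 0"
  "br e2 Y = 0" "br Y e2 = 0" "br E3 Y = 0" "br Y E3 = 0"
  "br A0 A0 = 0" "br A1 A1 = 0" "br Y Y = 0" "br E E = 0" "br e2 e2 = 0" "br E3 E3 = 0"
proof -
  \<comment> \<open>With \<open>e3\<close> gone, \<open>e5\<close> and \<open>br e2 e4\<close>
    vanish too, and \<open>Y\<close> becomes central.\<close>
  have e5: "e5 = 0" "e4 = 0" by (simp_all add: e5_def e4_def e3_zero br_linear)
  have *: "br E3 Y = 0" "br A1 Y = 0" using E3_Y A1_Y_e5 e5 by (simp_all add: br_linear)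
  have **: "br E Y = 0" by (simp add: E_bracket * r6 br_linear)
  have ***: "br e2 Y = 0" by (simp add: e2_bracket ** r6 br_linear)
  note t = A0_A1 A0_E A1_E A0_e2 e3_zero A1_e2 A0_E3 A1_E3 E_e2 X_zero E_E3 E3_e2 * ** *** r6 br_self
  show "br A0 A1 = E" "br A0 E = e2" "br A1 E = E3" "br A0 e2 = 0" "br A1 e2 = sc (- 4 * \<alpha>) E"
    "br A0 E3 = sc (- 4 * \<alpha>) E" "br A1 E3 = 0" "br E e2 = sc (- 4 * \<alpha>) e2"
    "br E E3 = sc (4 * \<alpha>) E3" "br E3 e2 = sc (16 * \<alpha>\<^sup>2) E"
    "br A0 Y = 0" "br A1 Y = 0" "br E Y = 0" "br e2 Y = 0" "br E3 Y = 0"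
    "br A0 A0 = 0" "br A1 A1 = 0" "br Y Y = 0" "br E E = 0" "br e2 e2 = 0" "br E3 E3 = 0"
    by (simp_all add: t)
  show "br A1 A0 = - E" "br E A0 = - e2" "br E A1 = - E3" "br e2 A0 = 0" "br e2 A1 = sc (4 * \<alpha>) E"
    "br E3 A0 = sc (4 * \<alpha>) E" "br E3 A1 = 0" "br e2 E = sc (4 * \<alpha>) e2"
    "br E3 E = sc (- 4 * \<alpha>) E3" "br e2 E3 = sc (- 16 * \<alpha>\<^sup>2) E"
    "br Y A0 = 0" "br Y A1 = 0" "br Y E = 0" "br Y e2 = 0" "br Y E3 = 0"
    by (subst br_anti, simp add: t)+
qed

end

section \<open>Power series with coefficients in a Lie algebra\<close>

text \<open>Series in the shifted variables \<open>x\<^sub>k = u\<^sub>k - a\<^sub>k\<close>: \<open>mulx k\<close> and \<open>mulu a k\<close> are multiplication by \<open>x\<^sub>k\<close> and by \<open>u\<^sub>k\<close>,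
  and \<open>emb s\<close> is the series \<open>\<Sum>i. x\<^sub>0\<^sup>i s\<^sub>i\<close>.\<close>
type_synonym ('i, 'k) series = "(nat \<Rightarrow> nat) \<Rightarrow> 'i \<Rightarrow> 'k"

definition scs :: "'k::field \<Rightarrow> ('i, 'k) series \<Rightarrow> ('i, 'k) series" where
  "scs c G = (\<lambda>m. sc c (G m))"

definition pd :: "nat \<Rightarrow> ('i, 'k::field) series \<Rightarrow> ('i, 'k) series" where
  "pd k G = (\<lambda>m. sc (of_nat (m k + 1)) (G (m(k := m k + 1))))"

definition mulx :: "nat \<Rightarrow> ('i, 'k::field) series \<Rightarrow> ('i, 'k) series" where
  "mulx k G = (\<lambda>m. if m k = 0 then 0 else G (m(k := m k - 1)))"

definition mulu :: "(nat \<Rightarrow> 'k) \<Rightarrow> nat \<Rightarrow> ('i, 'k::field) series \<Rightarrow> ('i, 'k) series" where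
  "mulu a k G = scs (a k) G + mulx k G"

definition cst :: "('i \<Rightarrow> 'k::field) \<Rightarrow> ('i, 'k) series" where
  "cst v = (\<lambda>m. if m = (\<lambda>_. 0) then v else 0)"

definition emb :: "(nat \<Rightarrow> 'i \<Rightarrow> 'k::field) \<Rightarrow> ('i, 'k) series" where
  "emb s = (\<lambda>m. if \<forall>k>0. m k = 0 then s (m 0) else 0)"

definition der :: "(nat \<Rightarrow> 'i \<Rightarrow> 'k::field) \<Rightarrow> nat \<Rightarrow> 'i \<Rightarrow> 'k" where
  "der s = (\<lambda>i. sc (of_nat (i + 1)) (s (i + 1)))"

lemma scs_apply: "scs c G m = sc c (G m)" by (simp add: scs_def)

lemma scs_linear:
  "scs c (F + G) = scs c F + scs c G" "scs c (F - G) = scs c F - scs c G" "scs c (- G) = - scs c G"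
  "scs c (scs d G) = scs (c * d) G" "scs c 0 = 0"
  by (auto simp: scs_def fun_eq_iff sc_def algebra_simps)

lemma pd_linear:
  "pd k (F + G) = pd k F + pd k G" "pd k (F - G) = pd k F - pd k G" "pd k (- G) = - pd k G"
  "pd k (scs c G) = scs c (pd k G)" "pd k 0 = 0"
  by (auto simp: pd_def scs_def fun_eq_iff sc_def algebra_simps)

lemma mulx_linear:
  "mulx k (F + G) = mulx k F + mulx k G" "mulx k (F - G) = mulx k F - mulx k G" "mulx k (- G) = - mulx k G"
  "mulx k (scs c G) = scs c (mulx k G)" "mulx k 0 = 0"
  by (auto simp: mulx_def scs_def fun_eq_iff sc_def algebra_simps)

lemma mulu_linear:
  "mulu a k (F + G) = mulu a k F + mulu a k G" "mulu a k (F - G) = mulu a k F - mulu a k G" "mulu a k (- G) = - mulu a k G"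
  "mulu a k (scs c G) = scs c (mulu a k G)" "mulu a k 0 = 0"
  by (simp_all add: mulu_def mulx_linear scs_linear algebra_simps)

lemma cst_linear:
  "cst (v + w) = cst v + cst w" "cst (v - w) = cst v - cst w" "cst (- v) = - cst v" "cst (sc c v) = scs c (cst v)" "cst 0 = 0"
  by (auto simp: cst_def scs_def fun_eq_iff sc_def)

lemma pd_pd: "pd j (pd k G) = pd k (pd j G)"
  by (cases "j = k") (auto simp: pd_def fun_eq_iff sc_def fun_upd_twist)

lemma pd_mulx: "pd k (mulx j G) = (if j = k then G else 0) + mulx j (pd k (G :: ('i, 'k::field) series))"
proof -
  have "pd k (mulx k G) = G + mulx k (pd k G)"
    by (auto simp: pd_def mulx_def fun_eq_iff sc_def algebra_simps Suc_diff_Suc)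
  moreover have "pd k (mulx j G) = mulx j (pd k G)" if "j \<noteq> k"
    using that by (auto simp: pd_def mulx_def fun_eq_iff sc_def fun_upd_twist)
  ultimately show ?thesis by auto
qed

lemma mulx_mulx: "mulx j (mulx k G) = mulx k (mulx j G)"
  by (cases "j = k") (auto simp: mulx_def fun_eq_iff fun_upd_twist)

lemma pd_mulu: "pd k (mulu a j G) = (if j = k then G else 0) + mulu a j (pd k G)"
  by (simp add: mulu_def pd_linear pd_mulx)

lemma mulu_mulu: "mulu a j (mulu a k G) = mulu a k (mulu a j G)"
  by (simp add: mulu_def mulx_linear mulx_mulx[of j k] scs_linear algebra_simps)

lemma pd_cst: "pd k (cst v) = 0"
  by (auto simp: pd_def cst_def fun_eq_iff sc_def)

lemma pd_emb: "pd k (emb s) = (if k = 0 then emb (der s) else 0)"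
  by (auto simp: pd_def emb_def der_def fun_eq_iff sc_def)

lemma cst_eq_0_iff: "cst v = 0 \<longleftrightarrow> v = 0"
  by (auto simp: cst_def fun_eq_iff)

lemma scs_eq_0_iff: "scs c G = 0 \<longleftrightarrow> c = 0 \<or> G = 0"
  by (auto simp: scs_def fun_eq_iff sc_def)

lemma pd_all_zero_imp_const:
  fixes G :: "('i, 'k::field_char_0) series"
  assumes "\<And>k. pd k G = 0"
  shows "G = cst (G (\<lambda>_. 0))"
proof
  fix m show "G m = cst (G (\<lambda>_. 0)) m"
  proof (cases "m = (\<lambda>_. 0)")
    case True then show ?thesis by (simp add: cst_def)
  next
    case False
    then obtain k where k: "m k \<noteq> 0" by auto
    have "pd k G (m(k := m k - 1)) = 0" using assms by simp
    then have "sc (of_nat (m k)) (G m) = 0" using k by (simp add: pd_def)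
    then show ?thesis using k False by (simp add: cst_def)
  qed
qed

section \<open>Brackets of series with A and with constants\<close>

context lie_alg
begin

text \<open>The bracket of the series A = \<open>emb s\<close> with \<open>G\<close>. As A depends
  on x_0 only, the Cauchy product runs over that exponent alone.\<close>

definition ad :: "(nat \<Rightarrow> 'i \<Rightarrow> 'k) \<Rightarrow> ('i, 'k) series \<Rightarrow> ('i, 'k) series" where
  "ad s G = (\<lambda>m. \<Sum>i\<le>m 0. br (s i) (G (m(0 := m 0 - i))))"

definition adc :: "('i \<Rightarrow> 'k) \<Rightarrow> ('i, 'k) series \<Rightarrow> ('i, 'k) series" where
  "adc v G = (\<lambda>m. br v (G m))"

lemma ad_linear:
  "ad s (F + G) = ad s F + ad s G" "ad s (F - G) = ad s F - ad s G" "ad s (- G) = - ad s G"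
  "ad s (scs c G) = scs c (ad s G)" "ad s 0 = 0"
  by (auto simp: ad_def fun_eq_iff br_linear scs_def sum.distrib sum_subtractf sum_negf sc.scale_sum_right)

lemma adc_linear:
  "adc s (F + G) = adc s F + adc s G" "adc s (F - G) = adc s F - adc s G" "adc s (- G) = - adc s G"
  "adc s (scs c G) = scs c (adc s G)" "adc s 0 = 0"
  by (auto simp: adc_def fun_eq_iff br_linear scs_def)

lemma adc_linear_left:
  "adc (v + w) G = adc v G + adc w G" "adc (v - w) G = adc v G - adc w G" "adc (- v) G = - adc v G"
  "adc (sc c v) G = scs c (adc v G)" "adc 0 G = 0"
  by (auto simp: adc_def fun_eq_iff br_linear scs_def)

lemma pd_adc: "pd k (adc v G) = adc v (pd k G)"
  by (auto simp: adc_def pd_def fun_eq_iff br_linear)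

lemma mulu_adc: "mulu a k (adc v G) = adc v (mulu a k G)"
  by (auto simp: adc_def mulu_def mulx_def scs_def fun_eq_iff br_linear)

lemma adc_cst: "adc v (cst w) = cst (br v w)"
  by (auto simp: adc_def cst_def fun_eq_iff br_linear)

lemma pd_ad: "k \<noteq> 0 \<Longrightarrow> pd k (ad s G) = ad s (pd k G)"
  by (auto simp: ad_def pd_def fun_eq_iff br_linear sc.scale_sum_right fun_upd_twist intro!: sum.cong)

lemma mulx_ad: "mulx k (ad s G) = ad s (mulx k G)"
proof (cases "k = 0")
  case True
  show ?thesis
  proof
    fix m :: "nat \<Rightarrow> nat"
    show "mulx k (ad s G) m = ad s (mulx k G) m"
    proof (cases "m 0")
      case 0 then show ?thesis using True by (simp add: mulx_def ad_def br_linear)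
    next
      case (Suc n)
      have "ad s (mulx 0 G) m = (\<Sum>i\<le>n. br (s i) (mulx 0 G (m(0 := Suc n - i))))"
        by (simp add: ad_def Suc mulx_def br_linear)
      also have "\<dots> = (\<Sum>i\<le>n. br (s i) (G (m(0 := n - i))))"
        by (intro sum.cong) (auto simp: mulx_def)
      finally show ?thesis using True Suc by (simp add: mulx_def ad_def)
    qed
  qed
next
  case False
  then show ?thesis
    by (auto simp: ad_def mulx_def fun_eq_iff br_linear fun_upd_twist intro!: sum.cong)
qed

lemma mulu_ad: "mulu a k (ad s G) = ad s (mulu a k G)"
  by (simp add: mulu_def mulx_ad ad_linear)

lemma pd_0_ad: "pd 0 (ad s G) = ad (der s) G + ad s (pd 0 G)"
proof
  fix m :: "nat \<Rightarrow> nat"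
  define n where "n = m 0"
  define b where "b i j = br (s i) (G (m(0 := j)))" for i j
  have "pd 0 (ad s G) m = (\<Sum>i\<le>Suc n. sc (of_nat (Suc n)) (b i (Suc n - i)))"
    by (simp add: pd_def ad_def n_def b_def sc.scale_sum_right del: sum.atMost_Suc)
  \<comment> \<open>The Leibniz rule comes from splitting the factor: n + 1 = i + (n + 1 -
    i).\<close>
  also have "\<dots> = (\<Sum>i\<le>Suc n. sc (of_nat i) (b i (Suc n - i)) + sc (of_nat (Suc n - i)) (b i (Suc n - i)))"
    by (intro sum.cong refl) (simp flip: sc.scale_left_distrib of_nat_add)
  also have "\<dots> = (\<Sum>i\<le>Suc n. sc (of_nat i) (b i (Suc n - i))) + (\<Sum>i\<le>Suc n. sc (of_nat (Suc n - i)) (b i (Suc n - i)))"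
    by (rule sum.distrib)
  also have "(\<Sum>i\<le>Suc n. sc (of_nat i) (b i (Suc n - i))) = (\<Sum>i\<le>n. sc (of_nat (Suc i)) (b (Suc i) (n - i)))"
    by (subst sum.atMost_Suc_shift) simp
  also have "\<dots> = ad (der s) G m"
    by (simp add: ad_def der_def n_def b_def br_linear)
  also have "(\<Sum>i\<le>Suc n. sc (of_nat (Suc n - i)) (b i (Suc n - i))) = (\<Sum>i\<le>n. sc (of_nat (Suc n - i)) (b i (Suc n - i)))"
    by simp
  also have "\<dots> = ad s (pd 0 G) m"
    by (auto simp: ad_def pd_def n_def b_def br_linear Suc_diff_le intro!: sum.cong)
  finally show "pd 0 (ad s G) m = (ad (der s) G + ad s (pd 0 G)) m" by (simp add: fun_eq_iff)
qed

text \<open>Reversing the Cauchy sum changes the sign of each bracket, so every coefficient is its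
  own negative.\<close>

lemma ad_emb_self: "ad s (emb s) = 0"
proof
  fix m :: "nat \<Rightarrow> nat"
  show "ad s (emb s) m = 0 m"
  proof (cases "\<forall>k>0. m k = 0")
    case True
    let ?z = "\<Sum>i\<le>m 0. br (s i) (s (m 0 - i))"
    have "?z = (\<Sum>i\<le>m 0. br (s (m 0 - i)) (s (m 0 - (m 0 - i))))"
      using sum.atLeastAtMost_rev[of "\<lambda>i. br (s i) (s (m 0 - i))" 0 "m 0"] by (simp add: atMost_atLeast0)
    also have "\<dots> = (\<Sum>i\<le>m 0. - br (s i) (s (m 0 - i)))"
      by (intro sum.cong refl) (subst br_anti, simp)
    also have "\<dots> = - ?z" by (simp add: sum_negf)
    finally have "sc 2 ?z = 0" by (simp add: pointwise)
    then have "?z = 0" by simp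
    with True show ?thesis by (simp add: ad_def emb_def)
  next
    case False
    then have "emb s (m(0 := j)) = 0" for j by (auto simp: emb_def)
    then show ?thesis by (simp add: ad_def br_linear)
  qed
qed

end

text \<open>Simplification collects repeated summands into a pointwise product with a numeral; this
  turns such a product back into a scalar multiple.\<close>

lemma numeral_times_series: "numeral n * G = scs (numeral n) G"
  by (simp add: fun_eq_iff scs_apply sc_apply)

section \<open>Solving the defining identity for A and B\<close>

context lie_alg
begin

declare One_nat_def [simp del]

text \<open>The left-hand side of the defining identity for \<open>F = u\<^sub>5 + c1 u\<^sub>1 u\<^sub>2 + c2 u\<^sub>0 u\<^sub>3 + c3 u\<^sub>0\<^sup>2 u\<^sub>1\<close>.\<close>
definition WE :: "'k \<Rightarrow> 'k \<Rightarrow> 'k \<Rightarrow> (nat \<Rightarrow> 'k) \<Rightarrow> (nat \<Rightarrow> 'i \<Rightarrow> 'k) \<Rightarrow> ('i, 'k) series \<Rightarrow> ('i, 'k) series" where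
  "WE c1 c2 c3 a s B =
     mulu a 1 (pd 0 B) + mulu a 2 (pd 1 B) + mulu a 3 (pd 2 B) + mulu a 4 (pd 3 B) + mulu a 5 (pd 4 B)
     - (mulu a 5 (emb (der s)) + scs c1 (mulu a 1 (mulu a 2 (emb (der s)))) + scs c2 (mulu a 0 (mulu a 3 (emb (der s))))
        + scs c3 (mulu a 0 (mulu a 0 (mulu a 1 (emb (der s)))))) + ad s B"

text \<open>Restricted to \<open>k < j\<close>, the commutation rules terminate as rewrite rules and
  sort nested operators by index.\<close>

lemma pd_pd_sorted: "k < j \<Longrightarrow> pd j (pd k G) = pd k (pd j G)"
  by (rule pd_pd)

lemma mulu_mulu_sorted: "k < j \<Longrightarrow> mulu a j (mulu a k G) = mulu a k (mulu a j G)"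
  by (rule mulu_mulu)

lemmas ops = numeral_times_series pd_linear mulu_linear ad_linear scs_linear pd_mulu pd_emb pd_0_ad
  pd_ad pd_pd_sorted mulu_mulu_sorted mulu_ad[symmetric] ad_emb_self
lemmas series_pointwise = plus_fun_apply minus_apply uminus_apply zero_fun_apply times_fun_apply
  numeral_fun_apply scs_apply sc_apply

text \<open>The variable u_k multiplies \<open>pd (k - 1) B\<close>, so differentiating the identity
  in u_k isolates that derivative once the higher ones are known. The first two conclusions express
  the compatibility of \<open>pd 1\<close> and \<open>pd 2\<close>.\<close>

lemma WE_zero_derivatives:
  assumes W: "WE c1 c2 c3 a s B = 0" and D5: "pd 5 B = 0"
  shows "emb (der (der (der s))) = 0" "ad s (emb (der (der s))) = 0"
    "pd 4 B = emb (der s)" "pd 3 B = - mulu a 1 (emb (der (der s))) - ad s (emb (der s))"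
    "pd 2 B = mulu a 2 (emb (der (der s))) + scs c2 (mulu a 0 (emb (der s))) + ad s (ad s (emb (der s)))"
proof -
  define J1 where "J1 = emb (der s)"
  define J2 where "J2 = emb (der (der s))"
  define J3 where "J3 = emb (der (der (der s)))"
  have DJ: "pd k J1 = (if k = 0 then J2 else 0)" "pd k J2 = (if k = 0 then J3 else 0)"
    "k \<noteq> 0 \<Longrightarrow> pd k J3 = 0" for k
    by (simp_all add: J1_def J2_def J3_def pd_emb)
  have adJ: "ad (der s) J1 = 0"
    by (simp add: J1_def ad_emb_self)
  note W' = W[unfolded WE_def, folded J1_def]
  note [simp] = ops DJ adJ D5
  have D4: "pd 4 B = J1"
    using arg_cong[OF W', of "pd 5"] by simp
  note [simp] = D4
  note raw3 = arg_cong[OF W', of "pd 4", simplified]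
  have D3: "pd 3 B = - mulu a 1 J2 - ad s J1"
  proof (rule ext)+
    fix m w show "(pd 3 B) m w = (- mulu a 1 J2 - ad s J1) m w"
      using raw3[THEN fun_cong, THEN fun_cong, of m w] by (simp only: series_pointwise) algebra
  qed

  note [simp] = D3
  note raw2 = arg_cong[OF W', of "pd 3", simplified]
  have D2: "pd 2 B = scs 2 (mulu a 1 (ad s J2)) + mulu a 1 (mulu a 1 J3) + mulu a 2 J2 + scs c2 (mulu a 0 J1) + ad s (ad s J1)"
  proof (rule ext)+
    fix m w show "(pd 2 B) m w = (scs 2 (mulu a 1 (ad s J2)) + mulu a 1 (mulu a 1 J3) + mulu a 2 J2 + scs c2 (mulu a 0 J1) + ad s (ad s J1)) m w"
      using raw2[THEN fun_cong, THEN fun_cong, of m w] by (simp only: series_pointwise) algebra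
  qed

  \<comment> \<open>The second derivative of the identity in u_2 determines
    \<open>pd 2 (pd 1 B)\<close>, and so does \<open>pd 1\<close> of \<open>D2\<close>. Together
    they give 5 (u_1 A''' + [A, A'']) = 0. Differentiating once more in u_1 separates the two
    terms.\<close>
  note raw1 = arg_cong[OF arg_cong[OF W', of "pd 2"], of "pd 2", simplified, unfolded D2, simplified]
  have "pd 2 (pd 1 B) = pd 1 (pd 2 B)" by (rule pd_pd)
  then have D12: "pd 2 (pd 1 B) = scs 2 (mulu a 1 J3) + scs 2 (ad s J2)"
     by (simp add: D2)
  have *: "scs 5 (mulu a 1 J3 + ad s J2) = 0"
  proof (rule ext)+
    fix m w show "scs 5 (mulu a 1 J3 + ad s J2) m w = 0 m w"
      using raw1[THEN fun_cong, THEN fun_cong, of m w] D12[THEN fun_cong, THEN fun_cong, of m w]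
      by (simp only: series_pointwise) algebra
  qed
  then have **: "mulu a 1 J3 + ad s J2 = 0" by (simp only: scs_eq_0_iff) simp
  have J3: "J3 = 0" using arg_cong[OF **, of "pd 1"] by simp
  have J2: "ad s J2 = 0" using ** by (simp add: J3)
  show "emb (der (der (der s))) = 0" "ad s (emb (der (der s))) = 0"
    using J3 J2 by (simp_all add: J3_def J2_def)
  show "pd 4 B = emb (der s)" "pd 3 B = - mulu a 1 (emb (der (der s))) - ad s (emb (der s))"
    "pd 2 B = mulu a 2 (emb (der (der s))) + scs c2 (mulu a 0 (emb (der s))) + ad s (ad s (emb (der s)))"
    using D4 D3 D2 by (simp_all add: J1_def J2_def[symmetric] J3 J2)
qed

lemma emb_eq_0D:
  assumes "emb t = 0"
  shows "t i = 0"
proof -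
  have "emb t ((\<lambda>_. 0)(0 := i)) = 0" by (simp only: assms zero_fun_apply)
  then show ?thesis by (simp add: emb_def)
qed

lemma truncate:
  assumes "\<And>i. i \<ge> 3 \<Longrightarrow> s i = 0"
  shows "ad s G = adc (s 0) G + mulx 0 (adc (s 1) G) + mulx 0 (mulx 0 (adc (s 2) G))"
proof
  fix m :: "nat \<Rightarrow> nat"
  define h where "h i = br (s i) (G (m(0 := m 0 - i)))" for i
  have h0: "h 0 = br (s 0) (G m)" by (simp add: h_def)
  have "ad s G m = (\<Sum>i\<in>{i. i < 3 \<and> i \<le> m 0}. h i)"
    unfolding ad_def h_def
    using assms by (intro sum.mono_neutral_right) (auto simp: br_linear not_less)
  also have "{i. i < 3 \<and> i \<le> m 0} = (if m 0 = 0 then {0} else if m 0 = 1 then {0, 1} else {0, 1, 2})"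
    by auto
  also have "sum h \<dots> = h 0 + (if m 0 \<ge> 1 then h 1 else 0) + (if m 0 \<ge> 2 then h 2 else 0)"
    by (auto simp: add.assoc)
  also have "\<dots> = (adc (s 0) G + mulx 0 (adc (s 1) G) + mulx 0 (mulx 0 (adc (s 2) G))) m"
    unfolding plus_fun_apply h0 by (auto simp: h_def adc_def mulx_def numeral_2_eq_2)
  finally show "ad s G m = (adc (s 0) G + mulx 0 (adc (s 1) G) + mulx 0 (mulx 0 (adc (s 2) G))) m" .
qed

lemma mulx_eq_mulu: "mulx k G = mulu a k G - scs (a k) G"
  by (simp add: mulu_def)

text \<open>Re-expansion of the quadratic polynomial A in powers of u_0 = a_0 + x_0; the
  combinations of \<open>s 0\<close>, \<open>s 1\<close> and \<open>s 2\<close> are its new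
  coefficients.\<close>

lemma truncate_mulu:
  assumes "\<And>i. i \<ge> 3 \<Longrightarrow> s i = 0"
  shows "ad s G = adc (s 0 - sc (a 0) (s 1) + sc ((a 0)\<^sup>2) (s 2)) G
    + mulu a 0 (adc (s 1 - sc (2 * a 0) (s 2)) G) + mulu a 0 (mulu a 0 (adc (s 2) G))"
  by (simp add: truncate[OF assms] mulx_eq_mulu[of _ _ a] mulu_linear adc_linear_left scs_linear power2_eq_square
      numeral_times_series algebra_simps)

lemma truncate_der:
  assumes "\<And>i. i \<ge> 3 \<Longrightarrow> s i = 0"
  shows "emb (der s) = cst (s 1 - sc (2 * a 0) (s 2)) + scs 2 (mulu a 0 (cst (s 2)))"
proof -
  have "emb (der s) = cst (s 1) + scs 2 (mulx 0 (cst (s 2)))"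
  proof
    fix m :: "nat \<Rightarrow> nat"
    show "emb (der s) m = (cst (s 1) + scs 2 (mulx 0 (cst (s 2)))) m"
    proof (cases "\<forall>k>0. m k = 0")
      case True
      then obtain n where m: "m = (\<lambda>_. 0)(0 := n)"
        by (intro that[of "m 0"]) auto
      have u: "(\<lambda>_. 0)(0 := j) = (\<lambda>_. 0 :: nat) \<longleftrightarrow> j = 0" for j :: nat
        by (auto simp: fun_eq_iff)
      consider "n = 0" | "n = 1" | "n \<ge> 2" by linarith
      then show ?thesis
      proof cases
        case 3
        then have "s (n + 1) = 0" using assms by simp
        then show ?thesis using 3
          by (simp add: m emb_def der_def cst_def mulx_def u scs_def plus_fun_apply)
      qed (simp_all add: m emb_def der_def cst_def mulx_def u scs_def plus_fun_apply one_add_one)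
    next
      case False
      then obtain k where "k > 0" "m k \<noteq> 0" by auto
      then have "m \<noteq> (\<lambda>_. 0)" "m(0 := j) \<noteq> (\<lambda>_. 0)" for j
        by (auto simp: fun_eq_iff intro!: exI[of _ k])
      with False show ?thesis
        by (auto simp: emb_def cst_def mulx_def scs_def plus_fun_apply)
    qed
  qed
  then show ?thesis
    by (simp add: mulx_eq_mulu[of _ _ a] cst_linear scs_linear mult.commute)
qed

text \<open>By \<open>WE_zero_derivatives\<close>, A is a quadratic polynomial whose leading
  coefficient \<open>p2\<close> commutes with the other two. The third derivative of the identity in
  u_1 then reads 6 (c1 - 2 c2) \<open>p2\<close> = 0.\<close>

lemma WE_zero_imp_linear:
  assumes W: "WE c1 c2 c3 a s B = 0" and D5: "pd 5 B = 0" and nz: "2 * c2 - c1 \<noteq> 0"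
  shows "i \<ge> 2 \<Longrightarrow> s i = 0"
proof -
  note st1 = WE_zero_derivatives[OF W D5]
  have s3: "s i = 0" if "i \<ge> 3" for i
  proof -
    have i: "i = Suc (Suc (Suc (i - 3)))" using that by simp
    have "der (der (der s)) (i - 3) = 0" by (rule emb_eq_0D[OF st1(1)])
    then show ?thesis by (subst i) (simp add: der_def One_nat_def del: of_nat_Suc)
  qed
  have der3: "der (der s) i = (if i = 0 then sc 2 (s 2) else 0)" for i
    using s3 by (auto simp: der_def numeral_2_eq_2 One_nat_def)
  \<comment> \<open>The second derivative of A is the constant 2 \<open>s 2\<close>, so the
    coefficient of [A, A''] at x_0^i is twice \<open>br (s i) (s 2)\<close>.\<close>
  have "br (s i) (s 2) = 0" for i
  proof -
    let ?m = "(\<lambda>_. 0 :: nat)(0 := i)"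
    have "ad s (emb (der (der s))) ?m = br (s i) (sc 2 (s 2))"
      unfolding ad_def emb_def der3
      by (subst sum.mono_neutral_right[of _ "{i}"]) (auto simp: br_linear)
    then show ?thesis by (simp add: st1(2) br_linear)
  qed
  then have c: "br (s 0) (s 2) = 0" "br (s 1) (s 2) = 0" by auto
  then have c': "br (s 2) (s 0) = 0" "br (s 2) (s 1) = 0"
    by (subst br_anti, simp)+
  define p0 where "p0 = s 0 - sc (a 0) (s 1) + sc ((a 0)\<^sup>2) (s 2)"
  define p1 where "p1 = s 1 - sc (2 * a 0) (s 2)"
  define p2 where "p2 = s 2"
  have ad: "ad s G = adc p0 G + mulu a 0 (adc p1 G) + mulu a 0 (mulu a 0 (adc p2 G))" for G
    unfolding p0_def p1_def p2_def by (rule truncate_mulu[OF s3])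
  have em: "emb (der s) = cst p1 + scs 2 (mulu a 0 (cst p2))"
    unfolding p1_def p2_def by (rule truncate_der[OF s3])
  have em2: "emb (der (der s)) = scs 2 (cst p2)"
  proof -
    have "emb (der (der s)) = pd 0 (emb (der s))" by (simp add: pd_emb)
    then show ?thesis by (simp add: em pd_linear pd_mulu pd_cst mulu_linear)
  qed
  have b: "br p0 p2 = 0" "br p1 p2 = 0" "br p2 p0 = 0" "br p2 p1 = 0"
    by (simp_all add: p0_def p1_def p2_def br_linear c c' br_self)
  have b2: "br p2 (br p0 p1) = 0" "br p2 (br p0 (br p0 p1)) = 0" "br p2 (br p1 (br p0 p1)) = 0"
    by (simp_all add: jacobi[of p2] b br_linear)
  define E where "E = br p0 p1"
  note b3 = b br_self b2[folded E_def] E_def[symmetric]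
  have b4: "br p1 p0 = - E" by (subst br_anti) (simp add: E_def)
  have E3: "br p1 (br p0 E) = br p0 (br p1 E)"
    by (subst jacobi) (simp add: b4 br_linear br_self)
  note [simp] = pd_linear mulu_linear adc_linear scs_linear cst_linear pd_mulu pd_cst pd_adc mulu_adc[symmetric] adc_cst
    numeral_times_series pd_pd_sorted pd_pd[of 1 0] mulu_mulu_sorted mulu_mulu[of _ 1 0] br_linear
  note [simp] = ad b3 b4 E3 em em2
  note W' = W[unfolded WE_def]
  note [simp] = D5 st1(3-5)
  note raw = arg_cong[OF W', of "pd 2", simplified]
  have D1: "pd 1 B = - (mulu a 1 (pd 0 (pd 2 B)) + mulu a 3 (pd 2 (pd 2 B))) + scs c1 (mulu a 1 (emb (der s))) - ad s (pd 2 B)"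
  proof (rule ext)+
    fix m w show "(pd 1 B) m w = ( - (mulu a 1 (pd 0 (pd 2 B)) + mulu a 3 (pd 2 (pd 2 B))) + scs c1 (mulu a 1 (emb (der s))) - ad s (pd 2 B)) m w"
      using raw[THEN fun_cong, THEN fun_cong, of m w] by (simp add: series_pointwise) (simp add: algebra_simps)?
  qed
  have D11: "pd 1 (pd 1 B) = scs (c1 - c2) (cst p1) - cst (br p1 E) + scs (2 * c1 - 4 * c2) (mulu a 0 (cst p2))"
    by (subst D1) (simp, (simp add: series_pointwise fun_eq_iff algebra_simps)?)
  note [simp] = D11
  note raw1 = arg_cong[OF W', of "pd 1", simplified]
  note raw2 = arg_cong[OF raw1, of "pd 1", simplified]
  note raw3 = arg_cong[OF raw2, of "pd 1", simplified]
  have "scs (6 * (c1 - 2 * c2)) (cst p2) = 0"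
    by (rule trans[OF _ raw3]) (simp add: series_pointwise fun_eq_iff algebra_simps)
  then have "p2 = 0" using nz by (simp add: scs_eq_0_iff cst_eq_0_iff)
  then show "s i = 0" if "i \<ge> 2" using s3[of i] that by (cases "i = 2") (auto simp: p2_def)
qed

lemma truncate2_mulu:
  assumes "\<And>i. i \<ge> 2 \<Longrightarrow> s i = 0"
  shows "ad s G = adc (s 0 - sc (a 0) (s 1)) G + mulu a 0 (adc (s 1) G)" "emb (der s) = cst (s 1)"
  using truncate_mulu[of s G a] truncate_der[of s a] assms[of 2] assms
  by (simp_all add: cst_linear mulu_linear adc_linear_left scs_linear)

lemma poly_eq_0D:
  fixes v0 v1 v2 v3 :: "'i \<Rightarrow> 'k"
  assumes e: "cst v0 + mulu a 0 (cst v1) + mulu a 0 (mulu a 0 (cst v2)) + mulu a 0 (mulu a 0 (mulu a 0 (cst v3))) = 0"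
  shows "v0 = 0" "v1 = 0" "v2 = 0" "v3 = 0"
proof -
  note rules = pd_linear pd_mulu pd_cst mulu_linear scs_linear numeral_times_series
  have "scs 6 (cst v3) = 0"
    using arg_cong[OF arg_cong[OF arg_cong[OF e, of "pd 0"], of "pd 0"], of "pd 0"]
    by (simp add: rules) (simp add: series_pointwise fun_eq_iff)
  then show 3: "v3 = 0" unfolding scs_eq_0_iff cst_eq_0_iff by simp
  have "scs 2 (cst v2) = 0"
    using arg_cong[OF arg_cong[OF e, of "pd 0"], of "pd 0"] 3
    by (simp add: rules cst_linear)
  then show 2: "v2 = 0" unfolding scs_eq_0_iff cst_eq_0_iff by simp
  have "cst v1 = 0"
    using arg_cong[OF e, of "pd 0"] 2 3 by (simp add: rules cst_linear)
  then show 1: "v1 = 0" unfolding cst_eq_0_iff .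
  show "v0 = 0" using e by (simp add: 1 2 3 cst_linear mulu_linear cst_eq_0_iff)
qed

text \<open>Obtained by integrating the derivatives of \<open>B\<close> found from \<open>WE = 0\<close>. The terms with \<open>e3\<close> vanish in h, but this
  is only known once all relations of h have been extracted.\<close>
definition Bsol :: "'k \<Rightarrow> 'k \<Rightarrow> (nat \<Rightarrow> 'k) \<Rightarrow> ('i \<Rightarrow> 'k) \<Rightarrow> ('i \<Rightarrow> 'k) \<Rightarrow> ('i, 'k) series" where
  "Bsol \<alpha> \<beta> a p q = (let E = br p q; e2 = br p E; E3 = br q E; e3 = br p e2 in
     mulu a 4 (cst q) - mulu a 3 (cst E) + mulu a 2 (cst e2) + mulu a 0 (mulu a 2 (cst (sc (8 * \<alpha> - 2 * \<beta>) q + E3)))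
     - scs (1/2) (mulu a 1 (mulu a 1 (cst (sc (4 * \<alpha> + 4 * \<beta>) q + E3))))
     + scs (2 * \<beta>) (mulu a 0 (mulu a 1 (cst E))) - mulu a 1 (cst e3) + mulu a 0 (cst (br p e3))
     + scs (1/2) (mulu a 0 (mulu a 0 (cst (br q e3 - sc (2 * \<beta>) e2))))
     - scs (1/3) (mulu a 0 (mulu a 0 (mulu a 0 (cst (sc (20 * \<alpha> * \<beta>) q + sc (2 * \<beta>) E3))))))"

text \<open>The relations come in two batches. The second derivative of the identity in u_1 gives
  the first two, which bring the derivatives of \<open>B\<close> into the form that is integrated.
  The other four are the coefficients of the cubic in u_0 that remains after the solution is
  substituted back.\<close>

lemma WE_zero_imp_relations:
  assumes W: "WE (4 * \<alpha> - 6 * \<beta>) (8 * \<alpha> - 2 * \<beta>) (- 20 * \<alpha> * \<beta>) a s B = 0"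
    and D5: "\<And>k. k \<ge> 5 \<Longrightarrow> pd k B = 0" and s: "\<And>i. i \<ge> 2 \<Longrightarrow> s i = 0"
    and p: "p = s 0 - sc (a 0) (s 1)" and q: "q = s 1"
    and Y: "Y = (B - Bsol \<alpha> \<beta> a p q) (\<lambda>_. 0)"
  shows "B = Bsol \<alpha> \<beta> a p q + cst Y"
    "br q (br q (br p q)) = 0" "sc (4 * \<alpha>) (br p q) + br p (br q (br p q)) = 0"
    "br q (br q (br p (br p (br p q)))) = 0"
    "br q (br p (br p (br p (br p q)))) - sc \<beta> (br p (br p (br p q)))
       + sc (1/2) (br p (br q (br p (br p (br p q))))) = 0"
    "br q Y + br p (br p (br p (br p (br p q)))) = 0" "br p Y = 0"
proof -
  have D5': "pd 5 B = 0" by (simp add: D5)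
  note st1 = WE_zero_derivatives[OF W D5']
  have ad: "ad s G = adc p G + mulu a 0 (adc q G)" for G
    unfolding p q by (rule truncate2_mulu[OF s])
  have em: "emb (der s) = cst q"
    unfolding q by (rule truncate2_mulu[OF s])
  have em2: "emb (der (der s)) = 0"
  proof -
    have "emb (der (der s)) = pd 0 (emb (der s))" by (simp add: pd_emb)
    then show ?thesis by (simp add: em pd_cst)
  qed
  define E where "E = br p q"
  define e2 where "e2 = br p E"
  define E3 where "E3 = br q E"
  define e3 where "e3 = br p e2"
  have anti: "br q p = - E" by (subst br_anti) (simp add: E_def)
  have qe2: "br q e2 = br p E3"
    unfolding e2_def E3_def by (subst jacobi) (simp add: anti br_linear br_self)
  note [simp] = pd_linear mulu_linear adc_linear scs_linear cst_linear pd_mulu pd_cst pd_adc mulu_adc[symmetric] adc_cst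
    numeral_times_series pd_pd_sorted pd_pd[of 1 0] mulu_mulu_sorted mulu_mulu[of _ 1 0] br_linear
  note [simp] = ad em em2 br_self anti qe2 E_def[symmetric] e2_def[symmetric] E3_def[symmetric] e3_def[symmetric]
  note W' = W[unfolded WE_def]
  note [simp] = D5' st1(3-5)
  note raw = arg_cong[OF W', of "pd 2", simplified]
  have D1: "pd 1 B = - mulu a 1 (pd 0 (pd 2 B)) + scs (4 * \<alpha> - 6 * \<beta>) (mulu a 1 (cst q)) - ad s (pd 2 B)"
  proof (rule ext)+
    fix m w show "(pd 1 B) m w = ( - mulu a 1 (pd 0 (pd 2 B)) + scs (4 * \<alpha> - 6 * \<beta>) (mulu a 1 (cst q)) - ad s (pd 2 B)) m w"
      using raw[THEN fun_cong, THEN fun_cong, of m w] by (simp add: series_pointwise) (simp add: algebra_simps)?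
  qed
  have D11: "pd 1 (pd 1 B) = - scs (4 * \<alpha> + 4 * \<beta>) (cst q) - cst E3"
    by (subst D1) (simp, (simp add: series_pointwise fun_eq_iff algebra_simps)?)
  note [simp] = D11
  have D01: "pd 0 (pd 1 B) = - scs (8 * \<alpha> - 2 * \<beta>) (cst E) - scs 2 (cst (br p E3)) - scs 2 (mulu a 0 (cst (br q E3)))"
    by (subst D1) (simp, (simp add: series_pointwise fun_eq_iff algebra_simps)?)
  note [simp] = D01
  \<comment> \<open>The second u_1-derivative \<open>raw2\<close> is linear in u_0: the first
    relation is the coefficient of u_0, the second is the constant term.\<close>
  note raw1 = arg_cong[OF W', of "pd 1", simplified]
  note raw2 = arg_cong[OF raw1, of "pd 1", simplified]
  note raw3 = arg_cong[OF raw2, of "pd 0", simplified]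
  have "scs (- 5) (cst (br q E3)) = 0"
    by (rule trans[OF _ raw3[THEN eq_iff_diff_eq_0[THEN iffD1]]]) (simp add: series_pointwise fun_eq_iff algebra_simps)
  then have 1: "br q E3 = 0" by (simp only: scs_eq_0_iff cst_eq_0_iff) simp
  have "scs (- 5) (cst (br p E3 - sc (- 4 * \<alpha>) E)) = 0"
    by (rule trans[OF _ raw2]) (simp add: 1, simp add: series_pointwise fun_eq_iff algebra_simps)
  then have "br p E3 - sc (- 4 * \<alpha>) E = 0" unfolding scs_eq_0_iff cst_eq_0_iff by simp
  then have 2: "br p E3 = sc (- 4 * \<alpha>) E" by (simp only: right_minus_eq)
  note [simp] = 1 2
  have D1': "pd 1 B = - mulu a 1 (cst (sc (4 * \<alpha> + 4 * \<beta>) q + E3)) + scs (2 * \<beta>) (mulu a 0 (cst E)) - cst e3"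
    by (subst D1) (simp del: D01, (simp add: series_pointwise fun_eq_iff algebra_simps)?)
  note [simp] = D1'
  note raw0 = arg_cong[OF W', of "pd 1", simplified]
  have D0: "pd 0 B = mulu a 2 (cst (sc (8 * \<alpha> - 2 * \<beta>) q + E3)) + scs (2 * \<beta>) (mulu a 1 (cst E)) + cst (br p e3)
      + mulu a 0 (cst (br q e3 - sc (2 * \<beta>) e2)) - mulu a 0 (mulu a 0 (cst (sc (20 * \<alpha> * \<beta>) q + sc (2 * \<beta>) E3)))"
    (is "_ = ?D0")
  proof (rule ext)+
    fix m w show "(pd 0 B) m w = ?D0 m w"
      using raw0[THEN fun_cong, THEN fun_cong, of m w] by (simp add: series_pointwise) algebra
  qed
  define Bg where "Bg = Bsol \<alpha> \<beta> a p q"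
  note Bg = Bg_def[unfolded Bsol_def Let_def, simplified]
  have "pd k (B - Bg) = 0" for k
  proof -
    consider "k = 0" | "k = 1" | "k = 2" | "k = 3" | "k = 4" | "k \<ge> 5" by linarith
    then show ?thesis
      by cases (simp_all add: Bg D5 D0, (simp_all add: series_pointwise fun_eq_iff algebra_simps)?)
  qed
  from pd_all_zero_imp_const[OF this]
  obtain Y' where Y': "B = Bg + cst Y'" and "Y' = (B - Bg) (\<lambda>_. 0)"
    by (metis add.commute diff_add_cancel)
  then have Y: "B = Bg + cst Y" using assms by (simp add: Bg_def)
  have LB: "adc p B = adc p Bg + cst (br p Y)" "adc q B = adc q Bg + cst (br q Y)"
    by (subst Y, simp)+
  note fin = W'[simplified, unfolded D0 LB Bg, simplified]
  \<comment> \<open>All terms with u_1, ..., u_5 cancel. The four coefficients in u_0 are, in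
    ascending order, the sixth, fifth, fourth and third relation of h, the last one halved.\<close>
  have "cst (br p Y) + mulu a 0 (cst (br q Y + br p (br p e3)))
      + mulu a 0 (mulu a 0 (cst (br q (br p e3) - sc \<beta> e3 + sc (1/2) (br p (br q e3)))))
      + mulu a 0 (mulu a 0 (mulu a 0 (cst (sc (1/2) (br q (br q e3)))))) = 0"
    by (rule trans[OF _ fin]) (simp, simp add: series_pointwise fun_eq_iff field_simps)
  note rels = poly_eq_0D[OF this]
  show "B = Bsol \<alpha> \<beta> a p q + cst Y" using Y by (simp add: Bg_def)
  show "br q (br q (br p q)) = 0" "sc (4 * \<alpha>) (br p q) + br p (br q (br p q)) = 0"
    "br q (br q (br p (br p (br p q)))) = 0"
    "br q (br p (br p (br p (br p q)))) - sc \<beta> (br p (br p (br p q)))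
       + sc (1/2) (br p (br q (br p (br p (br p q))))) = 0"
    "br q Y + br p (br p (br p (br p (br p q)))) = 0" "br p Y = 0"
    using rels by simp_all
qed

end

lemma (in lie_alg) pd_Bsol: "k \<ge> 5 \<Longrightarrow> pd k (Bsol \<alpha> \<beta> a p q) = 0"
  by (simp add: Bsol_def Let_def pd_linear pd_mulu pd_cst mulu_linear scs_linear)

context h_alg
begin

text \<open>In h the table \<open>brackets\<close> applies: \<open>e3\<close> is zero, which
  shortens \<open>Bsol\<close>, and \<open>Y\<close> is central, so \<open>cst Y\<close> contributes
  nothing.\<close>

lemma WE_Bsol:
  assumes "\<And>i. i \<ge> 2 \<Longrightarrow> s i = 0" and s1: "s 1 = A1" and s0: "s 0 = A0 + sc (a 0) A1"
  shows "WE (4 * \<alpha> - 6 * \<beta>) (8 * \<alpha> - 2 * \<beta>) (- 20 * \<alpha> * \<beta>) a s (Bsol \<alpha> \<beta> a A0 A1 + cst Y) = 0"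
proof -
  have ad: "ad s G = adc A0 G + mulu a 0 (adc A1 G)" for G
    using truncate2_mulu(1)[OF assms(1), where a = a] by (simp add: s0 s1)
  have em: "emb (der s) = cst A1"
    using truncate2_mulu(2)[OF assms(1)] by (simp add: s1)
  have B: "Bsol \<alpha> \<beta> a A0 A1 =
     mulu a 4 (cst A1) - mulu a 3 (cst E) + mulu a 2 (cst e2) + mulu a 0 (mulu a 2 (cst (sc (8 * \<alpha> - 2 * \<beta>) A1 + E3)))
     - scs (1/2) (mulu a 1 (mulu a 1 (cst (sc (4 * \<alpha> + 4 * \<beta>) A1 + E3))))
     + scs (2 * \<beta>) (mulu a 0 (mulu a 1 (cst E)))
     - scs \<beta> (mulu a 0 (mulu a 0 (cst e2)))
     - scs (1/3) (mulu a 0 (mulu a 0 (mulu a 0 (cst (sc (20 * \<alpha> * \<beta>) A1 + sc (2 * \<beta>) E3)))))"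
    by (simp add: Bsol_def Let_def brackets br_linear cst_linear mulu_linear scs_linear)
  note rules = pd_linear mulu_linear adc_linear scs_linear cst_linear pd_mulu pd_cst mulu_adc[symmetric] adc_cst
    numeral_times_series pd_pd_sorted mulu_mulu_sorted mulu_mulu[of _ 1 0] br_linear brackets
  show ?thesis
    unfolding WE_def ad em B by (simp add: rules) (simp add: series_pointwise fun_eq_iff field_simps)
qed

end

section \<open>Homomorphisms, quotients and substitutions\<close>

text \<open>The coefficients of \<open>Bsol\<close> are linear combinations of fixed Lie monomials in \<open>p\<close> and \<open>q\<close>, with scalars
  that do not depend on the Lie algebra. This makes \<open>Bsol\<close> commute with homomorphisms.\<close>
definition scal_shift :: "(nat \<Rightarrow> 'k::field) \<Rightarrow> nat \<Rightarrow> ((nat \<Rightarrow> nat) \<Rightarrow> 'k) \<Rightarrow> (nat \<Rightarrow> nat) \<Rightarrow> 'k" where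
  "scal_shift a k t = (\<lambda>m. a k * t m + (if m k = 0 then 0 else t (m(k := m k - 1))))"

definition scal_delta :: "(nat \<Rightarrow> nat) \<Rightarrow> 'k::field" where
  "scal_delta m = (if m = (\<lambda>_. 0) then 1 else 0)"

definition scal_mult :: "((nat \<Rightarrow> nat) \<Rightarrow> 'k::field) \<Rightarrow> ('i \<Rightarrow> 'k) \<Rightarrow> ('i, 'k) series" where
  "scal_mult t v = (\<lambda>m. sc (t m) v)"

lemma scal_mult_apply: "scal_mult t v m = sc (t m) v"
  by (simp add: scal_mult_def)

lemma cst_scal: "cst v = scal_mult scal_delta v"
  by (auto simp: cst_def scal_mult_def scal_delta_def)

lemma mulu_scal: "mulu a k (scal_mult t v) = scal_mult (scal_shift a k t) v"
  by (simp add: mulu_def mulx_def scs_def scal_shift_def scal_mult_def pointwise algebra_simps)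

text \<open>Relative to a subspace because a substitution is additive and multiplicative only on
  finitely supported functions, whereas the type contains all functions on words.\<close>

definition lie_hom_on :: "('i \<Rightarrow> 'k::field) set \<Rightarrow> (('i \<Rightarrow> 'k) \<Rightarrow> ('i \<Rightarrow> 'k) \<Rightarrow> ('i \<Rightarrow> 'k)) \<Rightarrow>
    (('j \<Rightarrow> 'k) \<Rightarrow> ('j \<Rightarrow> 'k) \<Rightarrow> ('j \<Rightarrow> 'k)) \<Rightarrow> (('i \<Rightarrow> 'k) \<Rightarrow> ('j \<Rightarrow> 'k)) \<Rightarrow> bool" where
  "lie_hom_on S br br' \<phi> \<longleftrightarrow> sc.subspace S \<and>
   (\<forall>x\<in>S. \<forall>y\<in>S. \<phi> (x + y) = \<phi> x + \<phi> y) \<and>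
   (\<forall>c. \<forall>x\<in>S. \<phi> (sc c x) = sc c (\<phi> x)) \<and>
   (\<forall>x\<in>S. \<forall>y\<in>S. br x y \<in> S \<and> \<phi> (br x y) = br' (\<phi> x) (\<phi> y))"

lemma lie_hom_onD:
  assumes "lie_hom_on S br br' \<phi>"
  shows "x \<in> S \<Longrightarrow> y \<in> S \<Longrightarrow> x + y \<in> S" "x \<in> S \<Longrightarrow> y \<in> S \<Longrightarrow> \<phi> (x + y) = \<phi> x + \<phi> y"
    "x \<in> S \<Longrightarrow> sc c x \<in> S" "x \<in> S \<Longrightarrow> \<phi> (sc c x) = sc c (\<phi> x)"
    "x \<in> S \<Longrightarrow> y \<in> S \<Longrightarrow> br x y \<in> S" "x \<in> S \<Longrightarrow> y \<in> S \<Longrightarrow> \<phi> (br x y) = br' (\<phi> x) (\<phi> y)"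
    "0 \<in> S" "\<phi> 0 = 0"
    "x \<in> S \<Longrightarrow> y \<in> S \<Longrightarrow> x - y \<in> S" "x \<in> S \<Longrightarrow> y \<in> S \<Longrightarrow> \<phi> (x - y) = \<phi> x - \<phi> y"
proof -
  note h = assms[unfolded lie_hom_on_def]
  show add: "x \<in> S \<Longrightarrow> y \<in> S \<Longrightarrow> x + y \<in> S" "x \<in> S \<Longrightarrow> y \<in> S \<Longrightarrow> \<phi> (x + y) = \<phi> x + \<phi> y" for x y
    using h by (auto intro: sc.subspace_add)
  show sc: "x \<in> S \<Longrightarrow> sc c x \<in> S" "x \<in> S \<Longrightarrow> \<phi> (sc c x) = sc c (\<phi> x)" for c x
    using h by (auto intro: sc.subspace_scale)
  show "x \<in> S \<Longrightarrow> y \<in> S \<Longrightarrow> br x y \<in> S" "x \<in> S \<Longrightarrow> y \<in> S \<Longrightarrow> \<phi> (br x y) = br' (\<phi> x) (\<phi> y)"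
    using h by auto
  show 0: "0 \<in> S" using h by (auto intro: sc.subspace_0)
  show "\<phi> 0 = 0" using sc(2)[OF 0, of 0] by simp
  show "x - y \<in> S" if "x \<in> S" "y \<in> S"
    using h that by (auto intro: sc.subspace_diff)
  have "x - y = x + sc (- 1) y" by simp
  then show "\<phi> (x - y) = \<phi> x - \<phi> y" if "x \<in> S" "y \<in> S"
    using add(2)[of x "sc (- 1) y"] sc[of y "- 1"] that by (simp add: diff_conv_add_uminus del: add_uminus_conv_diff)
qed

lemma Bsol_natural:
  fixes br1 :: "('i \<Rightarrow> 'k::field_char_0) \<Rightarrow> ('i \<Rightarrow> 'k) \<Rightarrow> ('i \<Rightarrow> 'k)"
    and br2 :: "('j \<Rightarrow> 'k) \<Rightarrow> ('j \<Rightarrow> 'k) \<Rightarrow> ('j \<Rightarrow> 'k)"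
  assumes l1: "lie_alg br1" and l2: "lie_alg br2" and h: "lie_hom_on S br1 br2 \<phi>"
    and p: "p \<in> S" and q: "q \<in> S"
  shows "lie_alg.Bsol br1 \<alpha> \<beta> a p q m \<in> S"
    "\<phi> (lie_alg.Bsol br1 \<alpha> \<beta> a p q m) = lie_alg.Bsol br2 \<alpha> \<beta> a (\<phi> p) (\<phi> q) m"
proof -
  note E1 = lie_alg.Bsol_def[OF l1, of \<alpha> \<beta> a p q, unfolded Let_def]
  note E2 = lie_alg.Bsol_def[OF l2, of \<alpha> \<beta> a "\<phi> p" "\<phi> q", unfolded Let_def]
  note rules = cst_scal mulu_scal plus_fun_apply minus_apply scs_apply scal_mult_apply
  show "lie_alg.Bsol br1 \<alpha> \<beta> a p q m \<in> S"
    unfolding E1 by (simp only: rules lie_hom_onD[OF h] p q)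
  show "\<phi> (lie_alg.Bsol br1 \<alpha> \<beta> a p q m) = lie_alg.Bsol br2 \<alpha> \<beta> a (\<phi> p) (\<phi> q) m"
    unfolding E1 E2 by (simp only: rules lie_hom_onD[OF h] p q)
qed

section \<open>The free associative algebra and quotients of free Lie algebras\<close>

lemma fa_eqs:
  "fa_zero = (0 :: 'g list \<Rightarrow> 'k::field)" "fa_add p q = p + (q :: 'g list \<Rightarrow> 'k)"
  "fa_diff p q = p - (q :: 'g list \<Rightarrow> 'k)" "fa_smult c p = sc c (p :: 'g list \<Rightarrow> 'k)"
  by (auto simp: fa_zero_def fa_add_def fa_diff_def fa_smult_def pointwise)

lemma fa_sum_eq: "fa_sum f A = sum f A"
  by (induction A rule: infinite_finite_induct) (auto simp: fa_sum_def fun_eq_iff)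

lemma fa_mult_Nil: "fa_mult p q [] = p [] * q []"
  by (simp add: fa_mult_def)

text \<open>Splitting off the empty prefix leaves the product of the left quotient of
  \<open>p\<close> by \<open>x\<close> with \<open>q\<close>. This recursion makes associativity an
  induction on the word.\<close>

lemma fa_mult_Cons: "fa_mult p q (x # w) = p [] * q (x # w) + fa_mult (\<lambda>v. p (x # v)) q w"
  by (simp add: fa_mult_def sum.atMost_Suc_shift del: sum.atMost_Suc)

lemma fa_mult_linear:
  "fa_mult (p + p') q = fa_mult p q + fa_mult p' q" "fa_mult p (q + q') = fa_mult p q + fa_mult p q'"
  "fa_mult (p - p') q = fa_mult p q - fa_mult p' q" "fa_mult p (q - q') = fa_mult p q - fa_mult p q'"
  "fa_mult (sc c p) q = sc c (fa_mult p q)" "fa_mult p (sc c q) = sc c (fa_mult p q)"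
  by (auto simp: fa_mult_def pointwise algebra_simps sum.distrib sum_distrib_left sum_subtractf)

lemma fa_mult_assoc: "fa_mult (fa_mult p q) r = fa_mult p (fa_mult q r)"
proof
  fix w show "fa_mult (fa_mult p q) r w = fa_mult p (fa_mult q r) w"
  proof (induction w arbitrary: p q r)
    case Nil show ?case by (simp add: fa_mult_Nil)
  next
    case (Cons x w)
    have "(\<lambda>v. fa_mult p q (x # v)) = sc (p []) (\<lambda>v. q (x # v)) + fa_mult (\<lambda>v. p (x # v)) q"
      by (auto simp: fa_mult_Cons pointwise)
    then have "fa_mult (fa_mult p q) r (x # w) =
        fa_mult p q [] * r (x # w) + (p [] * fa_mult (\<lambda>v. q (x # v)) r w
          + fa_mult (\<lambda>v. p (x # v)) (fa_mult q r) w)"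
      by (simp only: fa_mult_Cons[of "fa_mult p q"] fa_mult_linear Cons.IH plus_fun_apply sc_apply)
    then show ?case
      by (simp add: fa_mult_Cons fa_mult_Nil algebra_simps)
  qed
qed

interpretation fa: lie_alg "fa_br :: ('g list \<Rightarrow> 'k::field_char_0) \<Rightarrow> _"
  by unfold_locales (simp_all add: fa_br_def fa_eqs fa_mult_linear fa_mult_assoc algebra_simps sc.scale_right_diff_distrib)

lemma free_lie_subspace: "sc.subspace (free_lie :: ('g list \<Rightarrow> 'k::field) set)"
  using fl_zero fl_add fl_smult by (auto simp: sc.subspace_def fa_eqs)

lemma lie_ideal_subspace: "sc.subspace (lie_ideal R :: ('g list \<Rightarrow> 'k::field) set)"
  using li_zero li_add li_smult by (auto simp: sc.subspace_def fa_eqs)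

lemma lie_ideal_subset: "R \<subseteq> free_lie \<Longrightarrow> lie_ideal R \<subseteq> free_lie"
proof
  fix x assume "x \<in> lie_ideal R" and R: "R \<subseteq> free_lie"
  from this(1) show "x \<in> free_lie"
    by induction (use R in \<open>auto intro: free_lie.intros\<close>)
qed

text \<open>Extend a basis of \<open>I\<close> to one of \<open>S\<close>; send the basis of
  \<open>I\<close> to zero and the remaining vectors to themselves. All values lie in
  \<open>S\<close>, even for arguments outside \<open>S\<close>, so a bracket on the whole function
  space can project its arguments first.\<close>

lemma projection_exists:
  fixes I S :: "('i \<Rightarrow> 'k::field) set"
  assumes I: "sc.subspace I" and S: "sc.subspace S" and IS: "I \<subseteq> S"
  obtains \<pi> :: "('i \<Rightarrow> 'k) \<Rightarrow> ('i \<Rightarrow> 'k)"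
  where "Vector_Spaces.linear sc sc \<pi>" "\<And>x. \<pi> x \<in> S" "\<And>x. x \<in> S \<Longrightarrow> x - \<pi> x \<in> I" "\<And>x. x \<in> I \<Longrightarrow> \<pi> x = 0"
proof -
  interpret vector_space_pair "sc :: 'k \<Rightarrow> ('i \<Rightarrow> 'k) \<Rightarrow> _" "sc :: 'k \<Rightarrow> ('i \<Rightarrow> 'k) \<Rightarrow> _" ..
  obtain A where A: "A \<subseteq> I" "sc.independent A" "I \<subseteq> sc.span A"
    using sc.maximal_independent_subset by blast
  obtain B where B: "A \<subseteq> B" "B \<subseteq> S" "sc.independent B" "S \<subseteq> sc.span B"
    using sc.maximal_independent_subset_extend[of A S] A IS by blast
  obtain \<pi> where lin: "Vector_Spaces.linear sc sc \<pi>" and eq: "\<forall>x\<in>B. \<pi> x = (if x \<in> A then 0 else x)"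
    and range: "range \<pi> = sc.span ((\<lambda>x. if x \<in> A then 0 else x) ` B)"
    using linear_independent_extend_subspace[OF B(3), of "\<lambda>x. if x \<in> A then 0 else x"] by blast
  interpret \<pi>: Vector_Spaces.linear sc sc \<pi> by (rule lin)
  show ?thesis
  proof (rule that[OF lin])
    have "sc.span ((\<lambda>x. if x \<in> A then 0 else x) ` B) \<subseteq> S"
      using B(2) S by (intro sc.span_minimal) (auto intro: sc.subspace_0)
    then show "\<pi> x \<in> S" for x using range by auto
    show "x - \<pi> x \<in> I" if "x \<in> S" for x
    proof -
      have "x \<in> sc.span B" using that B(4) by auto
      then show ?thesis
      proof (induction rule: sc.span_induct_alt)
        case base show ?case using I \<pi>.zero by (metis diff_zero sc.subspace_0)
      next
        case (step c x y)
        have "x - \<pi> x \<in> I" using step(1) eq A(1) I by (auto intro: sc.subspace_0)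
        then have "sc c (x - \<pi> x) + (y - \<pi> y) \<in> I"
          using step I by (intro sc.subspace_add sc.subspace_scale)
        also have "sc c (x - \<pi> x) + (y - \<pi> y) = sc c x + y - \<pi> (sc c x + y)"
          unfolding \<pi>.add \<pi>.scale by (simp add: sc.scale_right_diff_distrib)
        finally show ?case .
      qed
    qed
    show "\<pi> x = 0" if "x \<in> I" for x
    proof -
      have "x \<in> sc.span A" using that A(3) by auto
      then show ?thesis
      proof (induction rule: sc.span_induct_alt)
        case base show ?case by (rule \<pi>.zero)
      next
        case (step c x y)
        have "\<pi> x = 0" using step(1) eq B(1) by auto
        with step show ?case unfolding \<pi>.add \<pi>.scale by simp
      qed
    qed
  qed
qed

lemma lie_ideal_br_right:
  assumes "x \<in> lie_ideal R" "y \<in> free_lie"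
  shows "fa_br x (y :: 'g list \<Rightarrow> 'k::field_char_0) \<in> lie_ideal R"
  using li_smult[OF li_br[OF assms], of "- 1"] by (subst fa.br_anti) (simp add: fa_eqs)

text \<open>The quotient Lie algebra lives on a vector space complement of the ideal; the bracket
  projected to the complement is extended to a bracket on the whole ambient space.\<close>
lemma quotient_lie_alg:
  fixes R :: "('g list \<Rightarrow> 'k::field_char_0) set"
  assumes R: "R \<subseteq> free_lie"
  obtains br and \<pi> :: "('g list \<Rightarrow> 'k) \<Rightarrow> ('g list \<Rightarrow> 'k)"
  where "lie_alg br" "lie_hom_on free_lie fa_br br \<pi>"
    "\<And>x. x \<in> free_lie \<Longrightarrow> \<pi> x = 0 \<longleftrightarrow> x \<in> lie_ideal R"
proof -
  obtain \<pi> where lin: "Vector_Spaces.linear sc sc \<pi>" and S: "\<And>x. \<pi> x \<in> free_lie"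
    and diff: "\<And>x. x \<in> free_lie \<Longrightarrow> x - \<pi> x \<in> lie_ideal R" and I: "\<And>x. x \<in> lie_ideal R \<Longrightarrow> \<pi> x = 0"
    using projection_exists[OF lie_ideal_subspace free_lie_subspace lie_ideal_subset[OF R]] by blast
  interpret \<pi>: Vector_Spaces.linear sc sc \<pi> by (rule lin)
  have eq: "\<pi> x = \<pi> y" if "x - y \<in> lie_ideal R" for x y
    using I[OF that] by (simp add: \<pi>.diff)
  have br: "fa_br x y \<in> free_lie" if "x \<in> free_lie" "y \<in> free_lie" for x y :: "'g list \<Rightarrow> 'k"
    using that by (rule fl_br)
  have hom1: "\<pi> (fa_br x (\<pi> y)) = \<pi> (fa_br x y)" if "x \<in> free_lie" "y \<in> free_lie" for x y
    using li_br[OF diff that(1), of y] that(2) by (intro eq[symmetric]) (simp add: fa.br_linear)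
  have hom2: "\<pi> (fa_br (\<pi> x) y) = \<pi> (fa_br x y)" if "x \<in> free_lie" "y \<in> free_lie" for x y
    using lie_ideal_br_right[OF diff that(2), of x] that(1) by (intro eq[symmetric]) (simp add: fa.br_linear)
  have idem: "\<pi> (\<pi> x) = \<pi> x" if "x \<in> free_lie" for x
    using diff[OF that] eq by metis
  show ?thesis
  proof (rule that[of "\<lambda>x y. \<pi> (fa_br (\<pi> x) (\<pi> y))" \<pi>])
    show "lie_alg (\<lambda>x y. \<pi> (fa_br (\<pi> x) (\<pi> y)))"
    proof
      fix x y z
      have 1: "\<pi> (fa_br (\<pi> a) (\<pi> (\<pi> (fa_br (\<pi> b) (\<pi> c))))) = \<pi> (fa_br (\<pi> a) (fa_br (\<pi> b) (\<pi> c)))" for a b c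
        by (simp add: S br idem hom1)
      have 2: "\<pi> (fa_br (\<pi> (\<pi> (fa_br (\<pi> b) (\<pi> c)))) (\<pi> a)) = \<pi> (fa_br (fa_br (\<pi> b) (\<pi> c)) (\<pi> a))" for a b c
        by (simp add: S br idem hom2)
      show "\<pi> (fa_br (\<pi> x) (\<pi> (\<pi> (fa_br (\<pi> y) (\<pi> z))))) =
        \<pi> (fa_br (\<pi> (\<pi> (fa_br (\<pi> x) (\<pi> y)))) (\<pi> z)) + \<pi> (fa_br (\<pi> y) (\<pi> (\<pi> (fa_br (\<pi> x) (\<pi> z)))))"
        unfolding 1 2 by (subst fa.jacobi) (simp add: \<pi>.add)
    qed (simp_all add: \<pi>.add \<pi>.scale \<pi>.zero fa.br_linear fa.br_self)
    show "lie_hom_on free_lie fa_br (\<lambda>x y. \<pi> (fa_br (\<pi> x) (\<pi> y))) \<pi>"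
      by (simp add: lie_hom_on_def free_lie_subspace \<pi>.add \<pi>.scale S hom1 hom2 br)
    show "\<pi> x = 0 \<longleftrightarrow> x \<in> lie_ideal R" if "x \<in> free_lie" for x
      using diff[OF that] I by auto
  qed
qed

section \<open>Evaluation of noncommutative polynomials\<close>

lemma fa_mult_support: "{w. fa_mult p q w \<noteq> 0} \<subseteq> (\<lambda>(u, v). u @ v) ` ({w. p w \<noteq> 0} \<times> {w. q w \<noteq> 0})"
proof
  fix w assume "w \<in> {w. fa_mult p q w \<noteq> 0}"
  then obtain i where "p (take i w) * q (drop i w) \<noteq> 0"
    unfolding fa_mult_def by (auto elim: sum.not_neutral_contains_not_neutral)
  then show "w \<in> (\<lambda>(u, v). u @ v) ` ({w. p w \<noteq> 0} \<times> {w. q w \<noteq> 0})"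
    by (intro image_eqI[of _ _ "(take i w, drop i w)"]) auto
qed

text \<open>The target algebra is general because evaluation serves twice: for substitutions between
  free algebras and for the representation by 2 x 2 matrices.\<close>

locale assoc_alg = vector_space scl for scl :: "'k::field \<Rightarrow> 'b::ab_group_add \<Rightarrow> 'b" +
  fixes mul :: "'b \<Rightarrow> 'b \<Rightarrow> 'b" and one :: 'b
  assumes mul_add: "mul (x + y) z = mul x z + mul y z" "mul z (x + y) = mul z x + mul z y"
    and mul_scl: "mul (scl c x) z = scl c (mul x z)" "mul z (scl c x) = scl c (mul z x)"
    and mul_assoc: "mul (mul x y) z = mul x (mul y z)"
    and mul_one: "mul one x = x" "mul x one = x"
begin

definition wprod :: "('g \<Rightarrow> 'b) \<Rightarrow> 'g list \<Rightarrow> 'b" where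
  "wprod s w = foldr (\<lambda>x. mul (s x)) w one"

definition ev :: "('g \<Rightarrow> 'b) \<Rightarrow> ('g list \<Rightarrow> 'k) \<Rightarrow> 'b" where
  "ev s p = (\<Sum>w | p w \<noteq> 0. scl (p w) (wprod s w))"

lemma wprod_append: "wprod s (u @ v) = mul (wprod s u) (wprod s v)"
  by (induction u) (simp_all add: wprod_def mul_one mul_assoc)

lemma mul_zero: "mul 0 x = 0" "mul x 0 = 0"
  using mul_scl(1)[of 0 0 x] mul_scl(2)[of x 0 0] by simp_all

lemma mul_sum: "mul (sum f A) x = (\<Sum>i\<in>A. mul (f i) x)" "mul x (sum f A) = (\<Sum>i\<in>A. mul x (f i))"
  by (induction A rule: infinite_finite_induct) (simp_all add: mul_add mul_zero)

lemma ev_superset: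
  assumes "finite A" "{w. p w \<noteq> 0} \<subseteq> A"
  shows "ev s p = (\<Sum>w\<in>A. scl (p w) (wprod s w))"
  unfolding ev_def using assms by (intro sum.mono_neutral_left) auto

lemma ev_add:
  assumes "finite {w. p w \<noteq> 0}" "finite {w. q w \<noteq> 0}"
  shows "ev s (p + q) = ev s p + ev s q"
proof -
  let ?A = "{w. p w \<noteq> 0} \<union> {w. q w \<noteq> 0}"
  have "finite ?A" using assms by simp
  then have "ev s (p + q) = (\<Sum>w\<in>?A. scl ((p + q) w) (wprod s w))"
    "ev s p = (\<Sum>w\<in>?A. scl (p w) (wprod s w))" "ev s q = (\<Sum>w\<in>?A. scl (q w) (wprod s w))"
    by (intro ev_superset; auto)+
  then show ?thesis by (simp add: scale_left_distrib sum.distrib)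
qed

lemma ev_sc: "ev s (sc c p) = scl c (ev s p)"
proof (cases "c = 0")
  case True then show ?thesis by (simp add: ev_def sc_apply)
next
  case False then show ?thesis by (simp add: ev_def sc_apply scale_sum_right)
qed

lemma ev_zero: "ev s 0 = 0"
  by (simp add: ev_def)

lemma ev_gen: "ev s (fa_gen x) = s x"
  by (simp add: ev_def fa_gen_def wprod_def mul_one)

lemma ev_mult:
  assumes p: "finite {w. p w \<noteq> 0}" and q: "finite {w. q w \<noteq> 0}"
  shows "ev s (fa_mult p q) = mul (ev s p) (ev s q)"
proof -
  let ?P = "{w. p w \<noteq> 0}" and ?Q = "{w. q w \<noteq> 0}"
  define A where "A = (\<lambda>(u, v). u @ v) ` (?P \<times> ?Q)"
  have fin: "finite A" using p q by (simp add: A_def)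
  have mem: "u @ v \<in> A" if "p u \<noteq> 0" "q v \<noteq> 0" for u v using that by (auto simp: A_def)
  let ?h = "\<lambda>(w, i). scl (p (take i w) * q (drop i w)) (wprod s w)"
  let ?T = "{(w, i). w \<in> A \<and> i \<le> length w \<and> p (take i w) \<noteq> 0 \<and> q (drop i w) \<noteq> 0}"
  have "ev s (fa_mult p q) = (\<Sum>w\<in>A. scl (fa_mult p q w) (wprod s w))"
    unfolding A_def by (rule ev_superset[OF fin[unfolded A_def] fa_mult_support])
  also have "\<dots> = (\<Sum>w\<in>A. \<Sum>i\<le>length w. scl (p (take i w) * q (drop i w)) (wprod s w))"
    by (simp add: fa_mult_def scale_sum_left)
  also have "\<dots> = sum ?h (Sigma A (\<lambda>w. {..length w}))"
    using fin by (subst sum.Sigma) auto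
  also have "\<dots> = sum ?h ?T"
    using fin by (intro sum.mono_neutral_right) auto
  \<comment> \<open>Without zero terms, the index set consists of factorizations of w into
    \<open>u\<close> and \<open>v\<close> from the two supports; the cut position is the length of
    \<open>u\<close>.\<close>
  also have "\<dots> = (\<Sum>(u, v)\<in>?P \<times> ?Q. scl (p u * q v) (wprod s (u @ v)))"
    using mem by (intro sum.reindex_bij_witness[where
          i = "\<lambda>(u, v). (u @ v, length u)" and j = "\<lambda>(w, i). (take i w, drop i w)"]) auto
  also have "\<dots> = mul (ev s p) (ev s q)"
    by (simp add: ev_def mul_sum mul_scl wprod_append sum.cartesian_product[symmetric] scale_sum_right)
       (simp add: mult.commute sum.swap[of _ ?P] )
  finally show ?thesis .
qed

end

lemma free_lie_finite_support: "p \<in> free_lie \<Longrightarrow> finite {w. p w \<noteq> 0}"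
proof (induction rule: free_lie.induct)
  case (fl_gen x) show ?case by (simp add: fa_gen_def)
next
  case fl_zero show ?case by (simp add: fa_zero_def)
next
  case (fl_add p q)
  then show ?case by (rule_tac finite_subset[of _ "{w. p w \<noteq> 0} \<union> {w. q w \<noteq> 0}"]) (auto simp: fa_add_def)
next
  case (fl_smult p c)
  then show ?case by (rule_tac finite_subset[of _ "{w. p w \<noteq> 0}"]) (auto simp: fa_smult_def)
next
  case (fl_br p q)
  have "finite {w. fa_mult p q w \<noteq> 0}" "finite {w. fa_mult q p w \<noteq> 0}"
    using fl_br.IH by (auto intro: finite_subset[OF fa_mult_support])
  then show ?case
    by (rule_tac finite_subset[of _ "{w. fa_mult p q w \<noteq> 0} \<union> {w. fa_mult q p w \<noteq> 0}"])
      (auto simp: fa_br_def fa_diff_def)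
qed

lemmas fun_apply = plus_fun_apply minus_apply uminus_apply zero_fun_apply

lemma lie_hom_on_comp:
  assumes "lie_hom_on S br br' f" "lie_hom_on T br' br'' g" "f ` S \<subseteq> T"
  shows "lie_hom_on S br br'' (g \<circ> f)"
  using assms unfolding lie_hom_on_def by (auto simp: image_subset_iff)

lemma lie_hom_on_eq:
  assumes "lie_hom_on free_lie fa_br br \<phi>" "lie_hom_on free_lie fa_br br \<psi>"
    and "\<And>x. \<phi> (fa_gen x) = \<psi> (fa_gen x)" and "p \<in> free_lie"
  shows "\<phi> p = \<psi> p"
  using assms(4)
  by induction (simp_all add: fa_eqs assms(3) lie_hom_onD[OF assms(1)] lie_hom_onD[OF assms(2)] del: fun_apply)

lemma lie_hom_on_lie_ideal:
  assumes h: "lie_hom_on free_lie fa_br br \<phi>" and br: "lie_alg br" and R: "R \<subseteq> free_lie"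
    and "\<And>r. r \<in> R \<Longrightarrow> \<phi> r = 0" and "p \<in> lie_ideal R"
  shows "\<phi> p = 0"
proof -
  interpret lie_alg br by (rule br)
  have m: "x \<in> free_lie" if "x \<in> lie_ideal R" for x using that lie_ideal_subset[OF R] by auto
  from assms(5) show ?thesis
    by induction (simp_all add: assms(4) fa_eqs lie_hom_onD[OF h] m br_linear del: fun_apply)
qed

definition fa_one :: "('g, 'k::field) fa" where
  "fa_one = (\<lambda>w. if w = [] then 1 else 0)"

interpretation fa_alg: assoc_alg "sc :: 'k::field \<Rightarrow> ('g, 'k) fa \<Rightarrow> _" fa_mult fa_one
proof
  fix x :: "('g, 'k) fa"
  have 0: "fa_mult 0 y w = 0" for y :: "('g, 'k) fa" and w
    by (simp add: fa_mult_def)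
  show "fa_mult fa_one x = x"
  proof
    fix w show "fa_mult fa_one x w = x w"
    proof (cases w)
      case (Cons g v)
      have "(\<lambda>v. fa_one (g # v)) = (0 :: ('g, 'k) fa)" by (simp add: fa_one_def fun_eq_iff)
      then show ?thesis by (simp only: Cons fa_mult_Cons 0) (simp add: fa_one_def)
    qed (simp add: fa_mult_Nil fa_one_def)
  qed
  show "fa_mult x fa_one = x"
  proof
    fix w show "fa_mult x fa_one w = x w"
      by (induction w arbitrary: x) (simp_all add: fa_mult_Nil fa_mult_Cons fa_one_def)
  qed
qed (simp_all add: fa_mult_linear fa_mult_assoc)

lemma (in assoc_alg) ev_diff:
  assumes "finite {w. p w \<noteq> 0}" "finite {w. q w \<noteq> 0}"
  shows "ev s (p - q) = ev s p - ev s q"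
proof -
  have "{w. sc (- 1) q w \<noteq> 0} = {w. q w \<noteq> 0}" by (simp add: sc_apply)
  then have "ev s (p + sc (- 1) q) = ev s p + ev s (sc (- 1) q)"
    using assms by (intro ev_add) simp_all
  then show ?thesis by (simp only: ev_sc) simp
qed

lemma (in assoc_alg) ev_fa_br:
  assumes "p \<in> free_lie" "q \<in> free_lie"
  shows "ev s (fa_br p q) = mul (ev s p) (ev s q) - mul (ev s q) (ev s p)"
proof -
  note p = free_lie_finite_support[OF assms(1)] and q = free_lie_finite_support[OF assms(2)]
  have "finite {w. fa_mult p q w \<noteq> 0}" "finite {w. fa_mult q p w \<noteq> 0}"
    using p q by (auto intro: finite_subset[OF fa_mult_support])
  then show ?thesis by (simp add: fa_br_def fa_eqs ev_diff ev_mult p q)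
qed

abbreviation "subst \<equiv> fa_alg.ev"

lemma subst_lie_hom: "lie_hom_on free_lie fa_br fa_br (subst s)"
  unfolding lie_hom_on_def
  by (auto simp: free_lie_subspace fa_alg.ev_add fa_alg.ev_sc fa_alg.ev_fa_br free_lie_finite_support free_lie.fl_br)
    (simp add: fa_br_def fa_eqs)

lemma subst_free_lie:
  assumes "\<And>x. s x \<in> free_lie" and "p \<in> free_lie"
  shows "subst s p \<in> free_lie"
  using assms(2)
proof induction
  case (fl_br p q)
  then show ?case by (simp add: lie_hom_onD(6)[OF subst_lie_hom] free_lie.fl_br)
qed (use assms(1) in \<open>simp_all add: fa_eqs fa_alg.ev_gen fa_alg.ev_sc fa_alg.ev_zero fa_alg.ev_add free_lie_finite_support
   sc.subspace_0 sc.subspace_add sc.subspace_scale free_lie_subspace del: fun_apply\<close>)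

text \<open>Everything is checked on generators and relations: each substitution sends relations to
  zero in the other quotient, and each composite is the identity on generators. The maps
  \<open>\<pi>1\<close> and \<open>\<pi>2\<close> turn membership in an ideal into an
  equation.\<close>

lemma pres_isoI:
  fixes R1 :: "('g1, 'k::field_char_0) fa set" and R2 :: "('g2, 'k) fa set"
  assumes R1: "R1 \<subseteq> free_lie" and R2: "R2 \<subseteq> free_lie"
    and 1: "lie_alg br1" "lie_hom_on free_lie fa_br br1 \<pi>1" "\<And>x. x \<in> free_lie \<Longrightarrow> \<pi>1 x = 0 \<longleftrightarrow> x \<in> lie_ideal R1"
    and 2: "lie_alg br2" "lie_hom_on free_lie fa_br br2 \<pi>2" "\<And>x. x \<in> free_lie \<Longrightarrow> \<pi>2 x = 0 \<longleftrightarrow> x \<in> lie_ideal R2"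
    and s: "\<And>x. s x \<in> free_lie" and t: "\<And>y. t y \<in> free_lie"
    and r1: "\<And>r. r \<in> R1 \<Longrightarrow> \<pi>2 (subst s r) = 0" and r2: "\<And>r. r \<in> R2 \<Longrightarrow> \<pi>1 (subst t r) = 0"
    and st: "\<And>x. \<pi>1 (subst t (s x)) = \<pi>1 (fa_gen x)" and ts: "\<And>y. \<pi>2 (subst s (t y)) = \<pi>2 (fa_gen y)"
  shows "pres_iso R1 R2"
proof -
  note fs = subst_free_lie[of s, OF s] and ft = subst_free_lie[of t, OF t]
  note hs = lie_hom_onD[OF subst_lie_hom[of s]] and ht = lie_hom_onD[OF subst_lie_hom[of t]]
  have h2: "lie_hom_on free_lie fa_br br2 (\<pi>2 \<circ> subst s)"
    using fs by (intro lie_hom_on_comp[OF subst_lie_hom 2(2)]) auto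
  have h1: "lie_hom_on free_lie fa_br br1 (\<pi>1 \<circ> subst t)"
    using ft by (intro lie_hom_on_comp[OF subst_lie_hom 1(2)]) auto
  have h1': "lie_hom_on free_lie fa_br br1 ((\<pi>1 \<circ> subst t) \<circ> subst s)"
    using fs by (intro lie_hom_on_comp[OF subst_lie_hom h1]) auto
  have h2': "lie_hom_on free_lie fa_br br2 ((\<pi>2 \<circ> subst s) \<circ> subst t)"
    using ft by (intro lie_hom_on_comp[OF subst_lie_hom h2]) auto
  have e1: "\<pi>1 (subst t (subst s x)) = \<pi>1 x" if "x \<in> free_lie" for x
    using lie_hom_on_eq[OF h1' 1(2) _ that] by (simp add: st fa_alg.ev_gen)
  have e2: "\<pi>2 (subst s (subst t x)) = \<pi>2 x" if "x \<in> free_lie" for x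
    using lie_hom_on_eq[OF h2' 2(2) _ that] by (simp add: ts fa_alg.ev_gen)
  have k1: "\<pi>2 (subst s x) = 0" if "x \<in> lie_ideal R1" for x
    using lie_hom_on_lie_ideal[OF h2 2(1) R1 _ that] r1 by simp
  have k2: "\<pi>1 (subst t x) = 0" if "x \<in> lie_ideal R2" for x
    using lie_hom_on_lie_ideal[OF h1 1(1) R2 _ that] r2 by simp
  have "subst s x \<in> lie_ideal R2 \<longleftrightarrow> x \<in> lie_ideal R1" if x: "x \<in> free_lie" for x
    using k1 k2 e1[OF x] 1(3)[OF x] 2(3)[OF fs[OF x]] by metis
  moreover have "\<exists>x\<in>free_lie. subst s x - y \<in> lie_ideal R2" if y: "y \<in> free_lie" for y
  proof (rule bexI)
    have "\<pi>2 (subst s (subst t y) - y) = 0"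
      using y fs ft by (simp add: lie_hom_onD[OF 2(2)] e2)
    then show "subst s (subst t y) - y \<in> lie_ideal R2"
      using 2(3) y fs ft by (metis free_lie_subspace sc.subspace_diff)
    show "subst t y \<in> free_lie" using ft y .
  qed
  ultimately show ?thesis
    unfolding pres_iso_def
    by (intro exI[of _ "subst s"]) (auto simp: fa_eqs fs hs sc.subspace_0[OF lie_ideal_subspace])
qed

lemma series_plus_apply: "(F + G) m = F m + G m"
  for F G :: "('i, 'k::field) series"
  by (rule plus_fun_apply)

section \<open>The prolongation relations as a power series identity\<close>

text \<open>The coefficient of x^n in the monomial u^e expanded about \<open>a\<close>.\<close>

definition taylor_mono :: "(nat \<Rightarrow> 'k::field) \<Rightarrow> (nat \<Rightarrow> nat) \<Rightarrow> (nat \<Rightarrow> nat) \<Rightarrow> 'k" where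
  "taylor_mono a e n = (\<Prod>r<6. of_nat (e r choose n r) * a r ^ (e r - n r))"

text \<open>The product of u^e with \<open>emb t\<close>; both involve x_0, hence the Cauchy
  sum.\<close>

definition mono_series :: "(nat \<Rightarrow> 'k::field) \<Rightarrow> (nat \<Rightarrow> nat) \<Rightarrow> (nat \<Rightarrow> 'i \<Rightarrow> 'k) \<Rightarrow> ('i, 'k) series" where
  "mono_series a e t = (\<lambda>m. if \<forall>r\<ge>6. m r = 0 then \<Sum>i\<le>m 0. sc (taylor_mono a e (m(0 := m 0 - i))) (t i) else 0)"

text \<open>Pascal's rule, expressing multiplication of a monomial by u_k = a_k + x_k.\<close>

lemma taylor_mono_Suc:
  assumes "k < 6"
  shows "taylor_mono a (e(k := Suc (e k))) n =
    a k * taylor_mono a e n + (if n k = 0 then 0 else taylor_mono a e (n(k := n k - 1)))"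
proof -
  let ?\<tau> = "\<lambda>e n r. of_nat (e r choose n r) * a r ^ (e r - n r)"
  have split: "taylor_mono a e n = ?\<tau> e n k * (\<Prod>r\<in>{..<6} - {k}. ?\<tau> e n r)" for e n
    unfolding taylor_mono_def using assms by (intro prod.remove) auto
  have "?\<tau> (e(k := Suc (e k))) n k = a k * ?\<tau> e n k + (if n k = 0 then 0 else ?\<tau> e (n(k := n k - 1)) k)"
  proof (cases "n k")
    case (Suc j)
    show ?thesis
    proof (cases "j < e k")
      case True
      then have "e k - j = Suc (e k - Suc j)" by simp
      then show ?thesis using Suc by (simp add: algebra_simps)
    next
      \<comment> \<open>Truncated subtraction stops the exponents at 0 here, and the binomials
        decide: only \<open>j = e k\<close> leaves a term.\<close>
      case False
      then show ?thesis using Suc by (cases "j = e k") (simp_all add: binomial_eq_0)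
    qed
  qed simp
  moreover have "(\<Prod>r\<in>{..<6} - {k}. ?\<tau> (e(k := x)) (n(k := y)) r) = (\<Prod>r\<in>{..<6} - {k}. ?\<tau> e n r)" for x y
    by (intro prod.cong) auto
  from this[of _ "n k"] this[of "e k"]
  have "(\<Prod>r\<in>{..<6} - {k}. ?\<tau> (e(k := x)) n r) = (\<Prod>r\<in>{..<6} - {k}. ?\<tau> e n r)"
    "(\<Prod>r\<in>{..<6} - {k}. ?\<tau> e (n(k := y)) r) = (\<Prod>r\<in>{..<6} - {k}. ?\<tau> e n r)" for x y
    by simp_all
  ultimately show ?thesis
    unfolding split by (simp add: algebra_simps del: binomial_Suc_Suc)
qed

lemma mono_series_Suc:
  assumes k: "k < 6"
  shows "mono_series a (e(k := Suc (e k))) t = mulu a k (mono_series a e t)"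
proof
  fix m :: "nat \<Rightarrow> nat"
  show "mono_series a (e(k := Suc (e k))) t m = mulu a k (mono_series a e t) m"
  proof (cases "\<forall>r\<ge>6. m r = 0")
    case False
    then obtain r where "r \<ge> 6" "m r \<noteq> 0" by auto
    then have "\<not> (\<forall>r\<ge>6. (m(k := j)) r = 0)" for j
      using k by (auto intro!: exI[of _ r])
    then have z: "mono_series a e' t (m(k := j)) = 0" for e' j
      by (simp only: mono_series_def if_False)
    then have "mono_series a e' t m = 0" for e' using z[of e' "m k"] by simp
    with z show ?thesis by (simp add: mulu_def mulx_def scs_def)
  next
    case True
    then have T: "\<forall>r\<ge>6. (m(k := j)) r = 0" for j using k by simp
    let ?n = "\<lambda>i. m(0 := m 0 - i)"
    have "mono_series a (e(k := Suc (e k))) t m = sc (a k) (mono_series a e t m)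
      + (\<Sum>i\<le>m 0. sc (if ?n i k = 0 then 0 else taylor_mono a e ((?n i)(k := ?n i k - 1))) (t i))"
      using True k by (simp only: mono_series_def taylor_mono_Suc if_P[OF True] sc.scale_left_distrib sum.distrib
        sc.scale_scale[symmetric] sc.scale_sum_right)
    also have "(\<Sum>i\<le>m 0. sc (if ?n i k = 0 then 0 else taylor_mono a e ((?n i)(k := ?n i k - 1))) (t i))
      = mulx k (mono_series a e t) m"
    proof (cases "k = 0")
      case True
      show ?thesis
      proof (cases "m 0")
        case 0 then show ?thesis using True by (simp add: mulx_def)
      next
        case (Suc j)
        have "m 0 - i - 1 = j - i" for i using Suc by simp
        then show ?thesis using T[of j] True Suc
          by (auto simp: mulx_def mono_series_def intro!: sum.cong)
      qed
    next
      case False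
      then show ?thesis using T[of "m k - 1"]
        by (auto simp: mulx_def mono_series_def fun_upd_twist intro!: sum.cong)
    qed
    finally show ?thesis by (simp only: mulu_def scs_def series_plus_apply)
  qed
qed

lemma mono_series_0: "mono_series a (\<lambda>_. 0) t = emb t"
proof
  fix m :: "nat \<Rightarrow> nat"
  have z: "taylor_mono a (\<lambda>_. 0) n = (if \<forall>r<6. n r = 0 then 1 else 0)" for n
    unfolding taylor_mono_def by (auto simp: binomial_eq_0 intro!: prod_zero bexI)
  show "mono_series a (\<lambda>_. 0) t m = emb t m"
  proof (cases "\<forall>k>0. m k = 0")
    case True
    then have "(\<forall>r<6. (m(0 := m 0 - i)) r = 0) \<longleftrightarrow> i = m 0" if "i \<le> m 0" for i
      using that by (auto simp: fun_upd_def)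
    then have "(\<Sum>i\<le>m 0. sc (taylor_mono a (\<lambda>_. 0) (m(0 := m 0 - i))) (t i)) = (\<Sum>i\<le>m 0. if i = m 0 then t i else 0)"
      by (intro sum.cong) (auto simp: z)
    then show ?thesis using True by (simp add: mono_series_def emb_def)
  next
    case False
    then obtain k where k: "k > 0" "m k \<noteq> 0" by auto
    have "(\<Sum>i\<le>m 0. sc (taylor_mono a (\<lambda>_. 0) (m(0 := m 0 - i))) (t i)) = 0" if "k < 6"
      using k that by (intro sum.neutral) (auto simp: z)
    moreover have "\<not> (\<forall>r\<ge>6. m r = 0)" if "k \<ge> 6" using k that by auto
    ultimately show ?thesis using False by (cases "k < 6") (auto simp: mono_series_def emb_def)
  qed
qed

lemma taylor_coeff_F_eq:
  "taylor_coeff (F_eq \<alpha> \<beta>) a n =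
     taylor_mono a ((\<lambda>_. 0)(5 := Suc 0)) n
   + (4 * \<alpha> - 6 * \<beta>) * taylor_mono a ((\<lambda>_. 0)(2 := Suc 0, 1 := Suc 0)) n
   + (8 * \<alpha> - 2 * \<beta>) * taylor_mono a ((\<lambda>_. 0)(3 := Suc 0, 0 := Suc 0)) n
   + (- 20 * \<alpha> * \<beta>) * taylor_mono a ((\<lambda>_. 0)(1 := Suc 0, 0 := Suc (Suc 0))) n"
proof -
  have e: "(\<lambda>r. if r = 5 then 1 else 0) = (\<lambda>_. 0 :: nat)(5 := Suc 0)"
    "(\<lambda>r. if r = 1 \<or> r = 2 then 1 else 0) = (\<lambda>_. 0 :: nat)(2 := Suc 0, 1 := Suc 0)"
    "(\<lambda>r. if r = 0 \<or> r = 3 then 1 else 0) = (\<lambda>_. 0 :: nat)(3 := Suc 0, 0 := Suc 0)"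
    "(\<lambda>r. if r = 0 then 2 else if r = 1 then 1 else 0) = (\<lambda>_. 0 :: nat)(1 := Suc 0, 0 := Suc (Suc 0))"
    by (auto simp: fun_eq_iff)
  show ?thesis
    unfolding taylor_coeff_def F_eq_def e
    by (simp add: taylor_mono_def del: fun_upd_apply)
qed

lemma mono_series_F:
  "mono_series a ((\<lambda>_. 0)(5 := Suc 0)) t = mulu a 5 (emb t)"
  "mono_series a ((\<lambda>_. 0)(2 := Suc 0, 1 := Suc 0)) t = mulu a 1 (mulu a 2 (emb t))"
  "mono_series a ((\<lambda>_. 0)(3 := Suc 0, 0 := Suc 0)) t = mulu a 0 (mulu a 3 (emb t))"
  "mono_series a ((\<lambda>_. 0)(1 := Suc 0, 0 := Suc (Suc 0))) t = mulu a 0 (mulu a 0 (mulu a 1 (emb t)))"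
  using mono_series_Suc[of 5 a "\<lambda>_. 0" t]
    mono_series_Suc[of 2 a "\<lambda>_. 0" t] mono_series_Suc[of 1 a "(\<lambda>_. 0)(2 := Suc 0)" t]
    mono_series_Suc[of 3 a "\<lambda>_. 0" t] mono_series_Suc[of 0 a "(\<lambda>_. 0)(3 := Suc 0)" t]
    mono_series_Suc[of 1 a "\<lambda>_. 0" t] mono_series_Suc[of 0 a "(\<lambda>_. 0)(1 := Suc 0)" t]
    mono_series_Suc[of 0 a "(\<lambda>_. 0)(1 := Suc 0, 0 := Suc 0)" t]
  by (simp_all add: mono_series_0)

text \<open>The relations have indices supported below 6 and test only \<open>m 5\<close>, while the
  series for B must vanish for all variables from index 5 on.\<close>

lemma all_ge_5_iff:
  fixes n :: "nat \<Rightarrow> nat"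
  assumes "\<forall>r\<ge>6. n r = 0"
  shows "(\<forall>r\<ge>5. n r = 0) \<longleftrightarrow> n 5 = 0"
proof -
  have "r = 5 \<or> r \<ge> 6" if "r \<ge> 5" for r :: nat using that by arith
  then show ?thesis using assms by auto
qed

text \<open>\<open>WB'\<close> ignores the entries from 5 on, so it is the guard that makes B
  independent of these variables.\<close>

definition WB_series :: "((wgen, 'k::field) fa \<Rightarrow> 'i \<Rightarrow> 'k) \<Rightarrow> ('i, 'k) series" where
  "WB_series \<phi> = (\<lambda>m. if \<forall>r\<ge>5. m r = 0 then \<phi> (WB' m) else 0)"

lemma WB'_free_lie: "WB' m \<in> free_lie" and WA'_free_lie: "WA' i \<in> free_lie"
  by (simp_all add: WB'_def WA'_def fl_gen)

lemma dB_free_lie: "dB k m \<in> (free_lie :: (wgen, 'k::field) fa set)"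
  unfolding dB_def by (auto intro: free_lie.intros WB'_free_lie)

lemma free_lie_sum: "(\<And>i. i \<in> A \<Longrightarrow> f i \<in> free_lie) \<Longrightarrow> sum f A \<in> (free_lie :: ('g, 'k::field) fa set)"
  by (rule sc.subspace_sum[OF free_lie_subspace])

lemma lie_hom_on_sum:
  fixes f :: "'a \<Rightarrow> ('g, 'k::field) fa"
  assumes h: "lie_hom_on free_lie fa_br br \<phi>" and f: "\<And>i. i \<in> A \<Longrightarrow> f i \<in> free_lie"
  shows "\<phi> (sum f A) = (\<Sum>i\<in>A. \<phi> (f i))"
  using f
  by (induction A rule: infinite_finite_induct) (simp_all add: lie_hom_onD[OF h] free_lie_sum del: fun_apply)

lemma WE_coeff_free_lie: "WE_coeff F a m \<in> (free_lie :: (wgen, 'k::field) fa set)"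
  unfolding WE_coeff_def fa_eqs fa_sum_eq
  by (auto intro!: fl_br WB'_free_lie WA'_free_lie dB_free_lie free_lie_subspace sc.subspace_add sc.subspace_diff sc.subspace_scale sc.subspace_0 free_lie_sum)

lemma WE_coeff_hom:
  fixes br :: "('i \<Rightarrow> 'k::field_char_0) \<Rightarrow> ('i \<Rightarrow> 'k) \<Rightarrow> ('i \<Rightarrow> 'k)"
  assumes br: "lie_alg br" and h: "lie_hom_on free_lie fa_br br \<phi>" and m: "\<forall>r\<ge>6. m r = 0"
  shows "\<phi> (WE_coeff (F_eq \<alpha> \<beta>) a m) =
    lie_alg.WE br (4 * \<alpha> - 6 * \<beta>) (8 * \<alpha> - 2 * \<beta>) (- 20 * \<alpha> * \<beta>) a (\<lambda>i. \<phi> (WA' i)) (WB_series \<phi>) m"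
proof -
  interpret lie_alg br by (rule br)
  define s where "s = (\<lambda>i. \<phi> (WA' i))"
  define B where "B = WB_series \<phi>"
  note hom = lie_hom_onD[OF h]
  note mem = WB'_free_lie WA'_free_lie dB_free_lie
  have dB: "\<phi> (dB k n) = pd k B n" if "k < 5" "\<forall>r\<ge>6. n r = 0" for k n
  proof -
    have "(\<forall>r\<ge>5. (n(k := n k + 1)) r = 0) \<longleftrightarrow> n 5 = 0"
      using that by (subst all_ge_5_iff) auto
    then show ?thesis
      by (simp add: dB_def pd_def B_def WB_series_def fa_eqs hom mem)
  qed
  have 1: "\<phi> (fa_sum (\<lambda>k. fa_add (fa_smult (a (k + 1)) (dB k m))
              (if 1 \<le> m (k + 1) then dB k (m(k + 1 := m (k + 1) - 1)) else fa_zero)) {..<5})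
      = (\<Sum>k<5. mulu a (k + 1) (pd k B) m)"
    unfolding fa_sum_eq fa_eqs
  proof (subst lie_hom_on_sum[OF h], goal_cases)
    case 1 then show ?case by (auto simp: hom mem)
  next
    case 2
    have "\<phi> (sc (a (k + 1)) (dB k m) + (if 1 \<le> m (k + 1) then dB k (m(k + 1 := m (k + 1) - 1)) else 0)) =
        mulu a (k + 1) (pd k B) m" if k: "k < 5" for k
    proof -
      have m': "\<forall>r\<ge>6. (m(k + 1 := m (k + 1) - 1)) r = 0" using m k by simp
      show ?thesis
        using dB[OF k m] dB[OF k m'] by (auto simp: hom mem mulu_def mulx_def scs_def simp del: fun_upd_apply)
    qed
    then show ?case by (intro sum.cong) auto
  qed
  have 2: "\<phi> (fa_sum (\<lambda>i. fa_smult (taylor_coeff (F_eq \<alpha> \<beta>) a (m(0 := m 0 - i)) * of_nat (i + 1)) (WA' (i + 1))) {..m 0})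
     = (\<Sum>i\<le>m 0. sc (taylor_coeff (F_eq \<alpha> \<beta>) a (m(0 := m 0 - i))) (der s i))"
    unfolding fa_sum_eq fa_eqs
    by (subst lie_hom_on_sum[OF h]) (simp_all add: hom mem der_def s_def)
  have 3: "(\<Sum>i\<le>m 0. sc (taylor_coeff (F_eq \<alpha> \<beta>) a (m(0 := m 0 - i))) (der s i)) =
     (mulu a 5 (emb (der s)) + scs (4 * \<alpha> - 6 * \<beta>) (mulu a 1 (mulu a 2 (emb (der s))))
        + scs (8 * \<alpha> - 2 * \<beta>) (mulu a 0 (mulu a 3 (emb (der s))))
        + scs (- 20 * \<alpha> * \<beta>) (mulu a 0 (mulu a 0 (mulu a 1 (emb (der s)))))) m"
    unfolding mono_series_F[symmetric] series_plus_apply scs_apply mono_series_def if_P[OF m] taylor_coeff_F_eq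
    by (simp only: sc.scale_left_distrib sum.distrib sc.scale_scale[symmetric] sc.scale_sum_right)
  have 4: "\<phi> (if m 5 = 0 then fa_sum (\<lambda>i. fa_br (WA' i) (WB' (m(0 := m 0 - i)))) {..m 0} else fa_zero) = ad s B m"
  proof (cases "m 5 = 0")
    case True
    have "\<forall>r\<ge>5. (m(0 := j)) r = 0" for j
      using m True by (subst all_ge_5_iff) auto
    then show ?thesis using True
      by (simp add: fa_sum_eq lie_hom_on_sum[OF h] hom mem ad_def s_def B_def WB_series_def)
  next
    case False
    then have "B (m(0 := j)) = 0" for j by (auto simp: B_def WB_series_def)
    then show ?thesis using False by (simp add: fa_eqs hom ad_def br_linear)
  qed
  have "{..<5::nat} = {0, 1, 2, 3, 4}" by auto
  then have 5: "(\<Sum>k<5. mulu a (k + 1) (pd k B) m) =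
      (mulu a 1 (pd 0 B) + mulu a 2 (pd 1 B) + mulu a 3 (pd 2 B) + mulu a 4 (pd 3 B) + mulu a 5 (pd 4 B)) m"
    by (simp add: plus_fun_apply add.assoc)
  let ?mulx = "fa_sum (\<lambda>k. fa_add (fa_smult (a (k + 1)) (dB k m))
              (if 1 \<le> m (k + 1) then dB k (m(k + 1 := m (k + 1) - 1)) else fa_zero)) {..<5}"
  let ?Y = "fa_sum (\<lambda>i. fa_smult (taylor_coeff (F_eq \<alpha> \<beta>) a (m(0 := m 0 - i)) * of_nat (i + 1)) (WA' (i + 1))) {..m 0}"
  let ?Z = "if m 5 = 0 then fa_sum (\<lambda>i. fa_br (WA' i) (WB' (m(0 := m 0 - i)))) {..m 0} else fa_zero"
  have "?mulx \<in> free_lie" "?Y \<in> free_lie" "?Z \<in> free_lie"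
    unfolding fa_eqs fa_sum_eq
    by (auto intro!: fl_br mem free_lie_subspace sc.subspace_add sc.subspace_scale sc.subspace_0 free_lie_sum)
  moreover have "\<phi> (fa_add (fa_diff x y) z) = \<phi> x - \<phi> y + \<phi> z"
    if "x \<in> free_lie" "y \<in> free_lie" "z \<in> free_lie" for x y z
    using that by (simp add: fa_eqs hom)
  ultimately have "\<phi> (WE_coeff (F_eq \<alpha> \<beta>) a m) = \<phi> ?mulx - \<phi> ?Y + \<phi> ?Z"
    unfolding WE_coeff_def by blast
  then show ?thesis
    unfolding 1 2 3 4 5 s_def[symmetric] B_def[symmetric] WE_def minus_apply plus_fun_apply[of _ "ad s B"] .
qed

text \<open>These rules also fire on eta-expanded arguments of homomorphisms and destroy sums there.\<close>
declare fun_apply [simp del]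

lemma series_minus_apply: "(F - G) m = F m - G m"
  for F G :: "('i, 'k::field) series"
  by (rule minus_apply)

section \<open>The isomorphism with h\<close>

definition multi_index :: "nat \<Rightarrow> nat \<Rightarrow> nat \<Rightarrow> nat \<Rightarrow> nat \<Rightarrow> nat \<Rightarrow> nat" where
  "multi_index j0 j1 j2 j3 j4 = (\<lambda>_. 0)(0 := j0, 1 := j1, 2 := j2, 3 := j3, 4 := j4)"

lemma WB'_multi_index: "WB' (multi_index j0 j1 j2 j3 j4) = fa_gen (WB j0 j1 j2 j3 j4)"
  by (simp add: WB'_def multi_index_def)

lemma multi_index_eq:
  assumes "\<forall>r\<ge>5. m r = 0"
  shows "multi_index (m 0) (m 1) (m 2) (m 3) (m 4) = m"
proof
  fix r :: nat
  consider "r = 0" | "r = 1" | "r = 2" | "r = 3" | "r = 4" | "r \<ge> 5" by linarith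
  then show "multi_index (m 0) (m 1) (m 2) (m 3) (m 4) r = m r"
    using assms by cases (auto simp: multi_index_def)
qed

lemma multi_index_ge_5: "r \<ge> 5 \<Longrightarrow> multi_index j0 j1 j2 j3 j4 r = 0"
  by (simp add: multi_index_def)

text \<open>Expanded about \<open>a\<close>, the series A = A0 + u_0 A1 has constant coefficient A0
  + a_0 A1; the coefficients of B are those of \<open>Bsol\<close> plus the constant Y.\<close>

definition to_h :: "'k::field_char_0 \<Rightarrow> 'k \<Rightarrow> (nat \<Rightarrow> 'k) \<Rightarrow> wgen \<Rightarrow> (hgen, 'k) fa" where
  "to_h \<alpha> \<beta> a x = (case x of
     WA i \<Rightarrow> if i = 0 then hA0 + sc (a 0) hA1 else if i = 1 then hA1 else 0
   | WB j0 j1 j2 j3 j4 \<Rightarrow> (fa.Bsol \<alpha> \<beta> a hA0 hA1 + cst hY) (multi_index j0 j1 j2 j3 j4))"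

text \<open>\<open>HY\<close> is the constant of integration, so the constant coefficient of
  \<open>Bsol\<close>, its value at the point \<open>a\<close>, is subtracted from that of
  B.\<close>

definition from_h :: "'k::field_char_0 \<Rightarrow> 'k \<Rightarrow> (nat \<Rightarrow> 'k) \<Rightarrow> hgen \<Rightarrow> (wgen, 'k) fa" where
  "from_h \<alpha> \<beta> a y = (case y of
     HA0 \<Rightarrow> WA' 0 - sc (a 0) (WA' 1)
   | HA1 \<Rightarrow> WA' 1
   | HY \<Rightarrow> WB' (\<lambda>_. 0) - fa.Bsol \<alpha> \<beta> a (WA' 0 - sc (a 0) (WA' 1)) (WA' 1) (\<lambda>_. 0))"

lemma hgen_free_lie: "hA0 \<in> free_lie" "hA1 \<in> free_lie" "hY \<in> free_lie"
  by (simp_all add: hA0_def hA1_def hY_def fl_gen)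

lemma h_rels_free_lie: "h_rels \<alpha> \<beta> \<subseteq> free_lie"
  unfolding h_rels_def fa_eqs
  by (auto intro!: fl_br hgen_free_lie free_lie_subspace sc.subspace_add sc.subspace_diff sc.subspace_scale)

lemma fa_hom_id: "lie_hom_on free_lie fa_br fa_br (\<lambda>x. x)"
  by (simp add: lie_hom_on_def free_lie_subspace fl_br)

lemma Bsol_free_lie: "p \<in> free_lie \<Longrightarrow> q \<in> free_lie \<Longrightarrow> fa.Bsol \<alpha> \<beta> a p q m \<in> free_lie"
  by (rule Bsol_natural(1)[OF fa.lie_alg_axioms fa.lie_alg_axioms fa_hom_id])

lemma cst_free_lie: "v \<in> free_lie \<Longrightarrow> cst v m \<in> free_lie"
  by (simp add: cst_def sc.subspace_0[OF free_lie_subspace])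

lemma to_h_free_lie: "to_h \<alpha> \<beta> a x \<in> free_lie"
  unfolding to_h_def series_plus_apply
  by (auto split: wgen.split intro!: sc.subspace_add sc.subspace_scale free_lie_subspace hgen_free_lie
      sc.subspace_0 Bsol_free_lie cst_free_lie)

lemma from_h_free_lie: "from_h \<alpha> \<beta> a y \<in> free_lie"
  unfolding from_h_def
  by (auto split: hgen.split intro!: sc.subspace_diff sc.subspace_scale free_lie_subspace
      Bsol_free_lie WA'_free_lie WB'_free_lie)

lemma h_alg_of_hom:
  assumes nz: "\<alpha> + \<beta> \<noteq> 0" "6 * \<alpha> + \<beta> \<noteq> 0" "16 * \<alpha> + \<beta> \<noteq> 0"
    and br: "lie_alg br" and h: "lie_hom_on free_lie fa_br br \<pi>"
    and 0: "\<And>r. r \<in> h_rels \<alpha> \<beta> \<Longrightarrow> \<pi> r = 0"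
  shows "h_alg br \<alpha> \<beta> (\<pi> hA0) (\<pi> hA1) (\<pi> hY)"
proof -
  interpret lie_alg br by (rule br)
  have "\<forall>r\<in>h_rels \<alpha> \<beta>. \<pi> r = 0" using 0 by blast
  then show ?thesis
    unfolding h_rels_def fa_eqs
    by (unfold_locales) (use nz in \<open>simp_all add: lie_hom_onD[OF h] hgen_free_lie del: fun_apply\<close>)
qed

lemma h_rels_hom_zero:
  assumes h: "lie_hom_on free_lie fa_br br \<pi>" and r: "r \<in> h_rels \<alpha> \<beta>"
   and "p = \<pi> hA0" "q = \<pi> hA1" "Y = \<pi> hY"
  and "br q (br q (br p q)) = 0" "sc (4 * \<alpha>) (br p q) + br p (br q (br p q)) = 0"
    "br q (br q (br p (br p (br p q)))) = 0"
    "br q (br p (br p (br p (br p q)))) - sc \<beta> (br p (br p (br p q)))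
       + sc (1/2) (br p (br q (br p (br p (br p q))))) = 0"
    "br q Y + br p (br p (br p (br p (br p q)))) = 0" "br p Y = 0"
  shows "\<pi> r = 0"
  using r assms(6-)
  unfolding h_rels_def fa_eqs assms(3-5)
  by (auto simp: lie_hom_onD[OF h] hgen_free_lie)

theorem pres_iso_WE_h:
  fixes \<alpha> \<beta> :: "'k::field_char_0" and a :: "nat \<Rightarrow> 'k"
  assumes nz: "\<alpha> + \<beta> \<noteq> 0" "6 * \<alpha> + \<beta> \<noteq> 0" "16 * \<alpha> + \<beta> \<noteq> 0"
  shows "pres_iso (WE_rels (F_eq \<alpha> \<beta>) a) (h_rels \<alpha> \<beta>)"
proof -
  let ?W = "WE_rels (F_eq \<alpha> \<beta>) a" and ?H = "h_rels \<alpha> \<beta>"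
  have W: "?W \<subseteq> free_lie" by (auto simp: WE_rels_def WE_coeff_free_lie)
  obtain brw and \<pi>w :: "(wgen, 'k) fa \<Rightarrow> (wgen, 'k) fa" where w: "lie_alg brw" "lie_hom_on free_lie fa_br brw \<pi>w"
    "\<And>x. x \<in> free_lie \<Longrightarrow> \<pi>w x = 0 \<longleftrightarrow> x \<in> lie_ideal ?W"
    by (rule quotient_lie_alg[OF W]) (rule that)
  obtain brh and \<pi>h :: "(hgen, 'k) fa \<Rightarrow> (hgen, 'k) fa" where h: "lie_alg brh" "lie_hom_on free_lie fa_br brh \<pi>h"
    "\<And>x. x \<in> free_lie \<Longrightarrow> \<pi>h x = 0 \<longleftrightarrow> x \<in> lie_ideal ?H"
    by (rule quotient_lie_alg[OF h_rels_free_lie]) (rule that)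
  let ?s = "to_h \<alpha> \<beta> a" and ?t = "from_h \<alpha> \<beta> a"
  let ?f = "\<pi>h \<circ> subst ?s" and ?g = "\<pi>w \<circ> subst ?t"
  have f: "lie_hom_on free_lie fa_br brh ?f"
    by (rule lie_hom_on_comp[OF subst_lie_hom h(2)]) (auto intro!: subst_free_lie to_h_free_lie)
  have g: "lie_hom_on free_lie fa_br brw ?g"
    by (rule lie_hom_on_comp[OF subst_lie_hom w(2)]) (auto intro!: subst_free_lie from_h_free_lie)
  interpret w: lie_alg brw by (rule w(1))
  have "h_alg brh \<alpha> \<beta> (\<pi>h hA0) (\<pi>h hA1) (\<pi>h hY)"
    using h(3) h_rels_free_lie by (intro h_alg_of_hom[OF nz h(1,2)]) (auto intro: li_rel)
  then interpret h: h_alg brh \<alpha> \<beta> "\<pi>h hA0" "\<pi>h hA1" "\<pi>h hY" .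
  note hh = lie_hom_onD[OF h(2)] and hw = lie_hom_onD[OF w(2)]

  have fA: "?f (WA' 0) = \<pi>h hA0 + sc (a 0) (\<pi>h hA1)" "?f (WA' 1) = \<pi>h hA1" "i \<ge> 2 \<Longrightarrow> ?f (WA' i) = 0" for i
    by (simp_all add: WA'_def fa_alg.ev_gen to_h_def hh hgen_free_lie)
  have fB: "WB_series ?f = h.Bsol \<alpha> \<beta> a (\<pi>h hA0) (\<pi>h hA1) + cst (\<pi>h hY)" (is "_ = ?B")
  proof
    fix m :: "nat \<Rightarrow> nat"
    show "WB_series ?f m = ?B m"
    proof (cases "\<forall>r\<ge>5. m r = 0")
      case True
      have "?f (WB' m) = \<pi>h ((fa.Bsol \<alpha> \<beta> a hA0 hA1 + cst hY) m)"
        using multi_index_eq[OF True] by (simp add: WB'_def fa_alg.ev_gen to_h_def)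
      also have "\<dots> = \<pi>h (fa.Bsol \<alpha> \<beta> a hA0 hA1 m) + \<pi>h (cst hY m)"
        unfolding series_plus_apply by (intro hh Bsol_free_lie cst_free_lie hgen_free_lie)
      also have "\<dots> = ?B m"
        unfolding series_plus_apply Bsol_natural(2)[OF fa.lie_alg_axioms h(1,2) hgen_free_lie(1,2)]
        by (simp add: cst_def hh)
      finally show ?thesis using True by (simp add: WB_series_def)
    next
      case False
      then obtain k where k: "k \<ge> 5" "m k \<noteq> 0" by auto
      have "pd k ?B = 0" using k by (simp add: pd_linear pd_cst h.pd_Bsol)
      then have "pd k ?B (m(k := m k - 1)) = 0" by (simp only: zero_fun_apply)
      then have "sc (of_nat (m k)) (?B m) = 0" using k by (simp add: pd_def)
      then have "?B m = 0" using k by (simp)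
      then show ?thesis by (simp only: WB_series_def if_not_P[OF False])
    qed
  qed
  have r1: "\<pi>h (subst ?s r) = 0" if "r \<in> ?W" for r
  proof -
    obtain m where r: "r = WE_coeff (F_eq \<alpha> \<beta>) a m" and m: "\<forall>r\<ge>6. m r = 0"
      using \<open>r \<in> ?W\<close> by (auto simp: WE_rels_def)
    have "?f r = 0" unfolding r WE_coeff_hom[OF h(1) f m] fB
      by (subst h.WE_Bsol) (simp_all only: fA zero_fun_apply)
    then show ?thesis by simp
  qed

  define s where "s = (\<lambda>i. \<pi>w (WA' i))"
  define B where "B = WB_series \<pi>w"
  have B0: "B m = 0" if "k \<ge> 5" "m k \<noteq> 0" for m k
    using that by (auto simp: B_def WB_series_def)
  have D5: "pd k B = 0" if "k \<ge> 5" for k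
  proof
    fix m :: "nat \<Rightarrow> nat"
    have "B (m(k := m k + 1)) = 0" using that by (intro B0[of k]) simp_all
    then show "pd k B m = 0 m" by (simp add: pd_def zero_fun_apply)
  qed
  have WE: "w.WE (4 * \<alpha> - 6 * \<beta>) (8 * \<alpha> - 2 * \<beta>) (- 20 * \<alpha> * \<beta>) a s B = 0"
  proof
    fix m :: "nat \<Rightarrow> nat"
    show "w.WE (4 * \<alpha> - 6 * \<beta>) (8 * \<alpha> - 2 * \<beta>) (- 20 * \<alpha> * \<beta>) a s B m = 0 m"
    proof (cases "\<forall>r\<ge>6. m r = 0")
      case True
      then have "WE_coeff (F_eq \<alpha> \<beta>) a m \<in> lie_ideal ?W" by (auto simp: WE_rels_def intro!: li_rel)
      then have "\<pi>w (WE_coeff (F_eq \<alpha> \<beta>) a m) = 0" using w(3)[OF WE_coeff_free_lie] by blast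
      then show ?thesis
        unfolding WE_coeff_hom[OF w(1,2) True] s_def B_def zero_fun_apply .
    next
      case False
      then obtain k where k: "k \<ge> 6" "m k \<noteq> 0" by auto
      \<comment> \<open>\<open>Z\<close> expresses that x_k does not occur. The presentation imposes
        no relation at such an index, but every operation in \<open>WE\<close> preserves
        \<open>Z\<close>, so the coefficient is zero.\<close>
      define Z where "Z = (\<lambda>G :: (wgen list, 'k) series. \<forall>m. m k \<noteq> 0 \<longrightarrow> G m = 0)"
      have Z: "Z B" "Z (emb t)" "Z G \<Longrightarrow> j < 6 \<Longrightarrow> Z (pd j G)" "Z G \<Longrightarrow> j < 6 \<Longrightarrow> Z (mulu a j G)"
        "Z G \<Longrightarrow> Z (scs c G)" "Z F \<Longrightarrow> Z G \<Longrightarrow> Z (F + G)" "Z F \<Longrightarrow> Z G \<Longrightarrow> Z (F - G)" "Z G \<Longrightarrow> Z (w.ad s G)" for F G j c t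
        using k B0[of k]
        by (auto simp: Z_def emb_def pd_def mulu_def mulx_def scs_def w.ad_def w.br_linear series_plus_apply minus_apply)
      have "Z (w.WE (4 * \<alpha> - 6 * \<beta>) (8 * \<alpha> - 2 * \<beta>) (- 20 * \<alpha> * \<beta>) a s B)"
        unfolding w.WE_def by (intro Z) simp_all
      then show ?thesis using k by (simp add: Z_def zero_fun_apply)
    qed
  qed
  have "2 * (8 * \<alpha> - 2 * \<beta>) - (4 * \<alpha> - 6 * \<beta>) = 2 * (6 * \<alpha> + \<beta>)" by simp
  then have "2 * (8 * \<alpha> - 2 * \<beta>) - (4 * \<alpha> - 6 * \<beta>) \<noteq> 0" using nz(2) by (metis mult_eq_0_iff zero_neq_numeral)
  then have s2: "s i = 0" if "i \<ge> 2" for i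
    using w.WE_zero_imp_linear[OF WE D5] that by blast
  define p where "p = s 0 - sc (a 0) (s 1)"
  define Y where "Y = (B - w.Bsol \<alpha> \<beta> a p (s 1)) (\<lambda>_. 0)"
  note st3 = w.WE_zero_imp_relations[OF WE D5 s2 p_def refl Y_def]
  have gA: "?g hA0 = p" "?g hA1 = s 1"
    by (simp_all add: hA0_def hA1_def fa_alg.ev_gen from_h_def hw WA'_free_lie p_def s_def)
  have gY: "?g hY = Y"
    by (simp add: hY_def fa_alg.ev_gen from_h_def hw WA'_free_lie WB'_free_lie Bsol_free_lie Y_def B_def p_def s_def
      WB_series_def Bsol_natural(2)[OF fa.lie_alg_axioms w(1,2)] series_minus_apply)
  have r2: "\<pi>w (subst ?t r) = 0" if "r \<in> ?H" for r
    using h_rels_hom_zero[OF g that gA[symmetric] gY[symmetric] st3(2-)] by simp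

  have st: "\<pi>w (subst ?t (?s x)) = \<pi>w (fa_gen x)" for x
  proof (cases x)
    case (WA i)
    have "?g (hA0 + sc (a 0) hA1) = s 0"
      by (simp add: lie_hom_onD[OF g] hgen_free_lie gA p_def del: o_apply)
    then have "?g (?s x) = s i"
      using s2[of i] gA lie_hom_onD(8)[OF g]
      by (cases "i = 0"; cases "i = 1") (simp_all add: WA to_h_def del: o_apply)
    then show ?thesis by (simp add: s_def WA WA'_def)
  next
    case (WB j0 j1 j2 j3 j4)
    let ?m = "multi_index j0 j1 j2 j3 j4"
    have "?g (?s x) = ?g (fa.Bsol \<alpha> \<beta> a hA0 hA1 ?m) + ?g (cst hY ?m)"
      unfolding WB to_h_def wgen.case series_plus_apply
      by (intro lie_hom_onD[OF g] Bsol_free_lie cst_free_lie hgen_free_lie)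
    also have "?g (fa.Bsol \<alpha> \<beta> a hA0 hA1 ?m) = w.Bsol \<alpha> \<beta> a p (s 1) ?m"
      using Bsol_natural(2)[OF fa.lie_alg_axioms w(1) g hgen_free_lie(1,2)] by (simp only: gA)
    also have "?g (cst hY ?m) = cst Y ?m"
      using gY lie_hom_onD(8)[OF g] by (simp add: cst_def del: o_apply)
    also have "w.Bsol \<alpha> \<beta> a p (s 1) ?m + cst Y ?m = B ?m"
      unfolding series_plus_apply[symmetric] by (simp only: st3(1)[symmetric])
    also have "\<dots> = \<pi>w (fa_gen x)"
      by (simp add: B_def WB_series_def multi_index_ge_5 WB'_multi_index WB)
    finally show ?thesis by simp
  qed
  have ts: "\<pi>h (subst ?s (?t y)) = \<pi>h (fa_gen y)" for y
  proof -
    note hf = lie_hom_onD[OF f]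
    have 1: "?f (WA' 0 - sc (a 0) (WA' 1)) = \<pi>h hA0"
      by (simp add: hf WA'_free_lie fA del: o_apply)
    have 2: "?f (WB' (\<lambda>_. 0)) = h.Bsol \<alpha> \<beta> a (\<pi>h hA0) (\<pi>h hA1) (\<lambda>_. 0) + \<pi>h hY"
      using fun_cong[OF fB, of "\<lambda>_. 0"] by (simp add: WB_series_def series_plus_apply cst_def)
    have "WA' 0 - sc (a 0) (WA' 1) \<in> (free_lie :: (wgen, 'k) fa set)"
      by (intro sc.subspace_diff sc.subspace_scale free_lie_subspace WA'_free_lie)
    note 3 = Bsol_natural(2)[OF fa.lie_alg_axioms h(1) f this WA'_free_lie]
      Bsol_free_lie[OF this WA'_free_lie]
    have "?f (?t y) = \<pi>h (fa_gen y)"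
    proof (cases y)
      case HY
      have "?f (?t y) = ?f (WB' (\<lambda>_. 0)) - ?f (fa.Bsol \<alpha> \<beta> a (WA' 0 - sc (a 0) (WA' 1)) (WA' 1) (\<lambda>_. 0))"
        unfolding HY from_h_def hgen.case by (intro hf WB'_free_lie 3(2))
      also have "\<dots> = \<pi>h hY" unfolding 2 3(1) 1 fA by simp
      finally show ?thesis by (simp only: HY hY_def)
    qed (use 1 fA(2) in \<open>simp_all add: from_h_def hA0_def hA1_def\<close>)
    then show ?thesis by simp
  qed
  show ?thesis
    by (rule pres_isoI[OF W h_rels_free_lie w h to_h_free_lie from_h_free_lie r1 r2 st ts])
qed

section \<open>The structure of h\<close>

definition (in h_alg) comb :: "'k \<Rightarrow> 'k \<Rightarrow> 'k \<Rightarrow> 'k \<Rightarrow> 'k \<Rightarrow> 'k \<Rightarrow> 'i \<Rightarrow> 'k" where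
  "comb c0 c1 c2 c3 c4 c5 = sc c0 A0 + sc c1 A1 + sc c2 Y + sc c3 E + sc c4 e2 + sc c5 E3"

lemma (in h_alg) br_comb:
  "br (comb c0 c1 c2 c3 c4 c5) (comb d0 d1 d2 d3 d4 d5) =
   comb 0 0 0
    (c0 * d1 - c1 * d0 + 4 * \<alpha> * (c4 * d1 - c1 * d4 + c5 * d0 - c0 * d5) + 16 * \<alpha>\<^sup>2 * (c5 * d4 - c4 * d5))
    (c0 * d3 - c3 * d0 + 4 * \<alpha> * (c4 * d3 - c3 * d4))
    (c1 * d3 - c3 * d1 + 4 * \<alpha> * (c3 * d5 - c5 * d3))"
  by (simp add: comb_def br_linear brackets) (simp add: pointwise algebra_simps)

lemma (in h_alg) comb_add:
  "comb c0 c1 c2 c3 c4 c5 + comb d0 d1 d2 d3 d4 d5 =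
   comb (c0 + d0) (c1 + d1) (c2 + d2) (c3 + d3) (c4 + d4) (c5 + d5)"
  by (simp add: comb_def pointwise algebra_simps)

lemma (in h_alg) sc_comb:
  "sc c (comb c0 c1 c2 c3 c4 c5) = comb (c * c0) (c * c1) (c * c2) (c * c3) (c * c4) (c * c5)"
  by (simp add: comb_def pointwise algebra_simps)

lemma (in h_alg) comb_0: "comb 0 0 0 0 0 0 = 0"
  by (simp add: comb_def)

definition hcomb :: "'k::field \<Rightarrow> 'k \<Rightarrow> 'k \<Rightarrow> 'k \<Rightarrow> 'k \<Rightarrow> 'k \<Rightarrow> (hgen, 'k) fa" where
  "hcomb c0 c1 c2 c3 c4 c5 = sc c0 hA0 + sc c1 hA1 + sc c2 hY
     + sc c3 (fa_br hA0 hA1) + sc c4 (fa_br hA0 (fa_br hA0 hA1)) + sc c5 (fa_br hA1 (fa_br hA0 hA1))"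

lemma hcomb_free_lie: "hcomb c0 c1 c2 c3 c4 c5 \<in> free_lie"
  unfolding hcomb_def by (intro sc.subspace_add sc.subspace_scale free_lie_subspace fl_br hgen_free_lie)

context
  fixes \<alpha> \<beta> :: "'k::field_char_0" and br and \<pi> :: "(hgen, 'k) fa \<Rightarrow> (hgen, 'k) fa"
  assumes h: "h_alg br \<alpha> \<beta> (\<pi> hA0) (\<pi> hA1) (\<pi> hY)"
    and hom: "lie_hom_on free_lie fa_br br \<pi>"
    and ker: "\<And>x. x \<in> free_lie \<Longrightarrow> \<pi> x = 0 \<longleftrightarrow> x \<in> lie_ideal (h_rels \<alpha> \<beta>)"
begin

interpretation h: h_alg br \<alpha> \<beta> "\<pi> hA0" "\<pi> hA1" "\<pi> hY" by (rule h)

lemma hom_hcomb: "\<pi> (hcomb c0 c1 c2 c3 c4 c5) = h.comb c0 c1 c2 c3 c4 c5"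
  by (simp add: hcomb_def h.comb_def lie_hom_onD[OF hom] hgen_free_lie h.E_def h.e2_def h.E3_def)

text \<open>The span of the six elements contains the generators and, by \<open>br_comb\<close>, is
  closed under brackets.\<close>

lemma hom_eq_comb:
  assumes "x \<in> free_lie"
  shows "\<exists>c0 c1 c2 c3 c4 c5. \<pi> x = h.comb c0 c1 c2 c3 c4 c5"
  using assms
proof induction
  case (fl_gen x)
  have "fa_gen HA0 = (hcomb 1 0 0 0 0 0 :: (hgen, 'k) fa)" "fa_gen HA1 = (hcomb 0 1 0 0 0 0 :: (hgen, 'k) fa)" "fa_gen HY = (hcomb 0 0 1 0 0 0 :: (hgen, 'k) fa)"
    by (simp_all add: hcomb_def hA0_def hA1_def hY_def)
  then have "\<pi> (fa_gen HA0) = h.comb 1 0 0 0 0 0" "\<pi> (fa_gen HA1) = h.comb 0 1 0 0 0 0"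
    "\<pi> (fa_gen HY) = h.comb 0 0 1 0 0 0"
    by (simp_all add: hom_hcomb)
  then show ?case by (cases x) blast+
next
  case fl_zero
  have "\<pi> fa_zero = h.comb 0 0 0 0 0 0"
    using h.comb_0 lie_hom_onD(8)[OF hom] by (simp add: fa_eqs)
  then show ?case by blast
next
  case (fl_add p q)
  then show ?case by (auto simp: fa_eqs lie_hom_onD[OF hom] h.comb_add) blast
next
  case (fl_smult p c)
  then show ?case by (auto simp: fa_eqs lie_hom_onD[OF hom] h.sc_comb) blast
next
  case (fl_br p q)
  then show ?case by (auto simp: lie_hom_onD[OF hom] h.br_comb) blast
qed

lemma eq_hcomb_mod:
  assumes x: "x \<in> free_lie"
  shows "\<exists>c0 c1 c2 c3 c4 c5. x - hcomb c0 c1 c2 c3 c4 c5 \<in> lie_ideal (h_rels \<alpha> \<beta>)"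
proof -
  obtain c0 c1 c2 c3 c4 c5 where c: "\<pi> x = h.comb c0 c1 c2 c3 c4 c5"
    using hom_eq_comb[OF x] by blast
  have "x - hcomb c0 c1 c2 c3 c4 c5 \<in> free_lie"
    by (intro sc.subspace_diff free_lie_subspace x hcomb_free_lie)
  moreover have "\<pi> (x - hcomb c0 c1 c2 c3 c4 c5) = 0"
    by (simp add: lie_hom_onD[OF hom] x hcomb_free_lie hom_hcomb c)
  ultimately show ?thesis using c ker by blast
qed

lemma hcomb_eq_fa_sum:
  "hcomb (c 0) (c 1) (c 2) (c 3) (c 4) (c 5) =
   fa_sum (\<lambda>i. fa_smult (c i) ([hA0, hA1, hY, fa_br hA0 hA1, fa_br hA0 (fa_br hA0 hA1), fa_br hA1 (fa_br hA0 hA1)] ! i)) {..<6}"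
proof -
  have "{..<6::nat} = {0, 1, 2, 3, 4, 5}" by auto
  then show ?thesis by (simp add: fa_sum_eq fa_eqs hcomb_def add.assoc)
qed

lemma dim_le_6: "pres_dim_le (h_rels \<alpha> \<beta>) 6"
  unfolding pres_dim_le_def
proof (intro exI conjI ballI)
  let ?adc = "[hA0, hA1, hY, fa_br hA0 hA1, fa_br hA0 (fa_br hA0 hA1), fa_br hA1 (fa_br hA0 hA1)] :: (hgen, 'k) fa list"
  show "length ?adc \<le> 6" by simp
  show "set ?adc \<subseteq> free_lie" by (auto intro!: fl_br hgen_free_lie)
  fix x :: "(hgen, 'k) fa" assume "x \<in> free_lie"
  then obtain c0 c1 c2 c3 c4 c5 where c: "x - hcomb c0 c1 c2 c3 c4 c5 \<in> lie_ideal (h_rels \<alpha> \<beta>)"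
    using eq_hcomb_mod by blast
  let ?c = "(!) [c0, c1, c2, c3, c4, c5]"
  have len: "length ?adc = 6" by simp
  have e: "hcomb c0 c1 c2 c3 c4 c5 = fa_sum (\<lambda>i. fa_smult (?c i) (?adc ! i)) {..<length ?adc}"
    unfolding len using hcomb_eq_fa_sum[of ?c] by simp
  have "hcomb c0 c1 c2 c3 c4 c5 \<in> fa_span ?adc"
    unfolding fa_span_def e by blast
  with c show "\<exists>y\<in>fa_span ?adc. fa_diff x y \<in> lie_ideal (h_rels \<alpha> \<beta>)" by (auto simp: fa_eqs)
qed

lemma lcs_Suc_induct:
  assumes "z \<in> lcs (Suc n)" and P: "sc.subspace P"
    and "\<And>x y. x \<in> free_lie \<Longrightarrow> y \<in> lcs n \<Longrightarrow> fa_br x y \<in> P"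
  shows "z \<in> P"
  using assms(1) unfolding lcs.simps
  by induction (use assms(3) P in \<open>auto simp: fa_eqs intro: sc.subspace_add sc.subspace_scale sc.subspace_0\<close>)

lemma lcs_free_lie: "lcs n \<subseteq> (free_lie :: ('g, 'k) fa set)"
proof (induction n)
  case (Suc n)
  then show ?case
    by (auto elim!: lcs_Suc_induct intro!: fl_br free_lie_subspace simp del: lcs.simps)
qed simp

text \<open>At \<alpha> = 0 the only nonzero brackets are, up to antisymmetry, [A0, A1] = E, [A0, E]
  = e2 and [A1, E] = E3. Successive terms of the series therefore lie in the span of E, e2, E3, in
  the span of e2, E3, and in zero.\<close>

lemma lcs_3_zero:
  assumes \<alpha>: "\<alpha> = 0"
  shows "lcs 3 \<subseteq> lie_ideal (h_rels \<alpha> \<beta>)"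
proof -
  note hh = lie_hom_onD[OF hom]
  have sub: "sc.subspace {z \<in> free_lie. \<pi> z \<in> Q}" if Q: "sc.subspace Q" for Q
    using Q free_lie_subspace unfolding sc.subspace_def by (auto simp: hh)
  let ?Q1 = "{h.comb 0 0 0 c3 c4 c5 | c3 c4 c5. True}" and ?Q2 = "{h.comb 0 0 0 0 c4 c5 | c4 c5. True}"
  have Q: "sc.subspace ?Q1" "sc.subspace ?Q2"
    unfolding sc.subspace_def using h.comb_0 by (fastforce simp: h.comb_add h.sc_comb)+
  have 1: "\<pi> z \<in> ?Q1" if "z \<in> lcs 1" for z
  proof -
    have "z \<in> {z \<in> free_lie. \<pi> z \<in> ?Q1}"
    proof (rule lcs_Suc_induct[OF _ sub[OF Q(1)]])
      show "z \<in> lcs (Suc 0)" using that by (simp only: One_nat_def)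
      fix x y :: "(hgen, 'k) fa" assume "x \<in> free_lie" "y \<in> lcs 0"
      then show "fa_br x y \<in> {z \<in> free_lie. \<pi> z \<in> ?Q1}"
        using hom_eq_comb[of x] hom_eq_comb[of y] by (auto simp: hh h.br_comb) blast
    qed
    then show ?thesis by simp
  qed
  have 2: "\<pi> z \<in> ?Q2" if "z \<in> lcs (Suc 1)" for z
  proof -
    have "z \<in> {z \<in> free_lie. \<pi> z \<in> ?Q2}"
    proof (rule lcs_Suc_induct[OF that sub[OF Q(2)]])
      fix x y :: "(hgen, 'k) fa" assume "x \<in> free_lie" "y \<in> lcs 1"
      moreover from this have "y \<in> free_lie" using lcs_free_lie by blast
      ultimately show "fa_br x y \<in> {z \<in> free_lie. \<pi> z \<in> ?Q2}"
        using hom_eq_comb[of x] 1[of y]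
        by (auto simp: hh h.br_comb \<alpha> simp del: lcs.simps) blast
    qed
    then show ?thesis by simp
  qed
  have 3: "\<pi> z = 0" if "z \<in> lcs (Suc (Suc 1))" for z
  proof -
    have "z \<in> {z \<in> free_lie. \<pi> z \<in> {0}}"
    proof (rule lcs_Suc_induct[OF that sub])
      show "sc.subspace {0}" by (rule sc.subspace_single_0)
      fix x y :: "(hgen, 'k) fa" assume "x \<in> free_lie" "y \<in> lcs (Suc 1)"
      moreover from this have "y \<in> free_lie" using lcs_free_lie by blast
      ultimately show "fa_br x y \<in> {z \<in> free_lie. \<pi> z \<in> {0}}"
        using hom_eq_comb[of x] 2[of y]
        by (auto simp: hh h.br_comb \<alpha> h.comb_0 simp del: lcs.simps)
    qed
    then show ?thesis by simp
  qed
  have "3 = Suc (Suc 1)" by simp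
  then show ?thesis using 3 ker lcs_free_lie[of 3] by (auto simp del: lcs.simps)
qed

end

section \<open>The matrix and vector model of h for nonzero \<alpha>\<close>

definition mat2 :: "'k::field \<Rightarrow> 'k \<Rightarrow> 'k \<Rightarrow> 'k \<Rightarrow> 'k ^ 2 ^ 2" where
  "mat2 p q r s = (\<chi> i j. if i = 1 then (if j = 1 then p else q) else (if j = 1 then r else s))"

definition vec3 :: "'k::field \<Rightarrow> 'k \<Rightarrow> 'k \<Rightarrow> 'k ^ 3" where
  "vec3 p q r = (\<chi> i. if i = 1 then p else if i = 2 then q else r)"

definition mat_scale :: "'k::field \<Rightarrow> 'k ^ 2 ^ 2 \<Rightarrow> 'k ^ 2 ^ 2" where
  "mat_scale c A = (\<chi> i j. c * A $ i $ j)"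

interpretation mat_alg: assoc_alg "mat_scale :: 'k::field \<Rightarrow> _" "(**)" "mat 1"
  by unfold_locales
    (auto simp: mat_scale_def vec_eq_iff matrix_matrix_mult_def mat_def sum_2 forall_2 algebra_simps)

lemma mat2_eqs:
  "mat2 p q r s ** mat2 p' q' r' s' = mat2 (p * p' + q * r') (p * q' + q * s') (r * p' + s * r') (r * q' + s * s')"
  "mat2 p q r s + mat2 p' q' r' s' = mat2 (p + p') (q + q') (r + r') (s + s')"
  "mat2 p q r s - mat2 p' q' r' s' = mat2 (p - p') (q - q') (r - r') (s - s')"
  "mat_scale c (mat2 p q r s) = mat2 (c * p) (c * q) (c * r) (c * s)"
  "(0 :: 'k::field ^ 2 ^ 2) = mat2 0 0 0 0"
  by (simp_all add: mat2_def mat_scale_def vec_eq_iff forall_2 matrix_matrix_mult_def sum_2)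

lemma mat2_eq_iff: "mat2 p q r s = mat2 p' q' r' s' \<longleftrightarrow> p = p' \<and> q = q' \<and> r = r' \<and> s = s'"
  by (auto simp: mat2_def vec_eq_iff forall_2)

lemma mat2_cases: "A = mat2 (A $ 1 $ 1) (A $ 1 $ 2) (A $ 2 $ 1) (A $ 2 $ 2)"
  by (simp add: mat2_def vec_eq_iff forall_2)

lemma mat2_trace: "mat2 p q r s $ 1 $ 1 + mat2 p q r s $ 2 $ 2 = p + s"
  by (simp add: mat2_def)

lemma vec3_cases: "v = vec3 (v $ 1) (v $ 2) (v $ 3)"
  by (simp add: vec3_def vec_eq_iff forall_3)

lemma vec3_eqs:
  "vec3 p q r + vec3 p' q' r' = vec3 (p + p') (q + q') (r + r')"
  "(\<chi> i. c * vec3 p q r $ i) = vec3 (c * p) (c * q) (c * r)"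
  "(0 :: 'k::field ^ 3) = vec3 0 0 0"
  by (simp_all add: vec3_def vec_eq_iff forall_3)

lemma vec3_eq_iff: "vec3 p q r = vec3 p' q' r' \<longleftrightarrow> p = p' \<and> q = q' \<and> r = r'"
  by (auto simp: vec3_def vec_eq_iff forall_3)

text \<open>The image of \<open>A\<^sub>1\<close> is scaled such that \<open>E\<^sub>1, E\<^sub>2, E\<^sub>3\<close> become multiples of the standard basis of
  \<open>sl\<^sub>2\<close> without square roots. The vector part records the coefficients of the words of length one, on
  which every bracket vanishes.\<close>
definition hmat :: "'k::field \<Rightarrow> hgen \<Rightarrow> 'k ^ 2 ^ 2" where
  "hmat \<alpha> x = (case x of HA0 \<Rightarrow> mat2 0 0 1 0 | HA1 \<Rightarrow> mat2 0 (- 2 * \<alpha>) 0 0 | HY \<Rightarrow> mat2 0 0 0 0)"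

definition hvec :: "(hgen, 'k::field) fa \<Rightarrow> 'k ^ 3" where
  "hvec p = vec3 (p [HY]) (p [HA0]) (p [HA1])"

definition to_tgt :: "'k::field \<Rightarrow> (hgen, 'k) fa \<Rightarrow> 'k tgt" where
  "to_tgt \<alpha> p = (mat_alg.ev (hmat \<alpha>) p, hvec p)"

text \<open>At a word of length one the product is \<open>p [] * q [x] + p [x] * q []\<close>, which
  is symmetric in \<open>p\<close> and \<open>q\<close>, so the commutator vanishes there.\<close>

lemma hvec_br: "hvec (fa_br p q) = 0"
  by (simp add: hvec_def vec3_eqs vec3_eq_iff fa_br_def fa_diff_def fa_mult_def mult.commute)

lemma hvec_add: "hvec (p + q) = hvec p + hvec q"
  by (simp add: hvec_def vec3_eqs fun_apply)

lemma hvec_sc: "hvec (sc c p) = (\<chi> i. c * hvec p $ i)"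
  by (simp add: hvec_def vec3_eqs sc_apply)

lemma to_tgt_add: "p \<in> free_lie \<Longrightarrow> q \<in> free_lie \<Longrightarrow> to_tgt \<alpha> (p + q) = tgt_add (to_tgt \<alpha> p) (to_tgt \<alpha> q)"
  by (simp add: to_tgt_def tgt_add_def mat_alg.ev_add free_lie_finite_support hvec_add)

lemma to_tgt_sc: "to_tgt \<alpha> (sc c p) = tgt_smult c (to_tgt \<alpha> p)"
  by (simp add: to_tgt_def tgt_smult_def mat_alg.ev_sc hvec_sc mat_scale_def)

lemma to_tgt_br: "p \<in> free_lie \<Longrightarrow> q \<in> free_lie \<Longrightarrow> to_tgt \<alpha> (fa_br p q) = tgt_br (to_tgt \<alpha> p) (to_tgt \<alpha> q)"
  by (simp add: to_tgt_def tgt_br_def mat_alg.ev_fa_br hvec_br)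

lemma hvec_gen: "hvec (fa_gen x) = (case x of HA0 \<Rightarrow> vec3 0 1 0 | HA1 \<Rightarrow> vec3 0 0 1 | HY \<Rightarrow> vec3 1 0 0)"
  by (cases x) (simp_all add: hvec_def fa_gen_def)

lemma to_tgt_gen:
  "to_tgt \<alpha> hA0 = (mat2 0 0 1 0, vec3 0 1 0)" "to_tgt \<alpha> hA1 = (mat2 0 (- 2 * \<alpha>) 0 0, vec3 0 0 1)"
  "to_tgt \<alpha> hY = (mat2 0 0 0 0, vec3 1 0 0)"
  by (simp_all add: to_tgt_def hA0_def hA1_def hY_def mat_alg.ev_gen hmat_def hvec_gen)

lemma tgt_eqs:
  "tgt_add (mat2 p q r s, vec3 x y z) (mat2 p' q' r' s', vec3 x' y' z') =
    (mat2 (p + p') (q + q') (r + r') (s + s'), vec3 (x + x') (y + y') (z + z'))"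
  "tgt_smult c (mat2 p q r s, vec3 x y z) = (mat2 (c * p) (c * q) (c * r) (c * s), vec3 (c * x) (c * y) (c * z))"
  "tgt_br (mat2 p q r s, vec3 x y z) (mat2 p' q' r' s', vec3 x' y' z') =
    (mat2 (q * r' - q' * r) (p * q' + q * s' - (p' * q + q' * s)) (r * p' + s * r' - (r' * p + s' * r)) (r * q' - r' * q), vec3 0 0 0)"
  using mat2_eqs(4)[unfolded mat_scale_def]
  by (simp_all add: tgt_add_def tgt_smult_def tgt_br_def mat2_eqs(1-3) vec3_eqs mat2_eq_iff algebra_simps)

lemma to_tgt_hcomb:
  "to_tgt \<alpha> (hcomb c0 c1 c2 c3 c4 c5) =
    (mat2 (2 * \<alpha> * c3) (8 * \<alpha>\<^sup>2 * c5 - 2 * \<alpha> * c1) (c0 + 4 * \<alpha> * c4) (- 2 * \<alpha> * c3), vec3 c2 c0 c1)"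
proof -
  note sub = sc.subspace_add[OF free_lie_subspace] sc.subspace_scale[OF free_lie_subspace] fl_br hgen_free_lie
  show ?thesis
    unfolding hcomb_def
    by (simp add: to_tgt_add to_tgt_sc to_tgt_br to_tgt_gen sub tgt_eqs mat2_eq_iff vec3_eq_iff power2_eq_square algebra_simps)
qed

lemma to_tgt_rels:
  assumes "r \<in> h_rels \<alpha> \<beta>"
  shows "to_tgt \<alpha> r = (0, 0)"
proof -
  note sub = sc.subspace_add[OF free_lie_subspace] sc.subspace_scale[OF free_lie_subspace]
    sc.subspace_diff[OF free_lie_subspace] fl_br hgen_free_lie
  have diff: "to_tgt \<alpha> (p - q) = tgt_add (to_tgt \<alpha> p) (tgt_smult (- 1) (to_tgt \<alpha> q))"
    if "p \<in> free_lie" "q \<in> free_lie" for p q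
    using to_tgt_add[of p "sc (- 1) q" \<alpha>] to_tgt_sc[of \<alpha> "- 1" q] that sub(2)[of q "- 1"] by simp
  have "\<forall>r\<in>h_rels \<alpha> \<beta>. to_tgt \<alpha> r = (0, 0)"
    unfolding h_rels_def fa_eqs
    by (simp add: to_tgt_add to_tgt_sc to_tgt_br to_tgt_gen diff sub tgt_eqs mat2_eqs(5) vec3_eqs(3) mat2_eq_iff vec3_eq_iff)
       (simp add: power2_eq_square algebra_simps)?
  then show ?thesis using assms by blast
qed

lemma to_tgt_ideal:
  assumes "x \<in> lie_ideal (h_rels \<alpha> \<beta>)"
  shows "to_tgt \<alpha> x = (0, 0)"
proof -
  have m: "x \<in> free_lie" if "x \<in> lie_ideal (h_rels \<alpha> \<beta>)" for x
    using that lie_ideal_subset[OF h_rels_free_lie] by blast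
  from assms show ?thesis
  proof induction
    case li_zero
    have "to_tgt \<alpha> (sc 0 0) = (0, 0)" by (simp only: to_tgt_sc tgt_smult_def) (simp add: vec_eq_iff)
    then show ?case by (simp add: fa_eqs)
  next
    case (li_add p q)
    then show ?case by (simp add: fa_eqs to_tgt_add m tgt_add_def)
  next
    case (li_smult p c)
    then show ?case by (simp add: fa_eqs to_tgt_sc tgt_smult_def vec_eq_iff)
  next
    case (li_br p q)
    then show ?case by (simp add: to_tgt_br m tgt_br_def)
  qed (rule to_tgt_rels)
qed

lemma fa_span_3: "fa_span [x, y, z] = {sc c x + sc d y + sc e z | c d e. True}"
proof -
  have 3: "{..<3::nat} = {0, 1, 2}" by auto
  have "fa_sum (\<lambda>i. fa_smult (c i) ([x, y, z] ! i)) {..<length [x, y, z]} = sc (c 0) x + sc (c 1) y + sc (c 2) z"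
    for c :: "nat \<Rightarrow> 'b"
    by (simp add: fa_sum_eq fa_eqs 3[simplified numeral_3_eq_3] numeral_2_eq_2 add.assoc)
  note e = this
  show ?thesis
    unfolding fa_span_def e
  proof safe
    fix c d e :: 'b
    show "\<exists>ca :: nat \<Rightarrow> 'b. sc c x + sc d y + sc e z = sc (ca 0) x + sc (ca 1) y + sc (ca 2) z \<and> True"
      by (rule exI[of _ "(!) [c, d, e]"]) (simp add: numeral_2_eq_2)
  qed blast
qed

context
  fixes \<alpha> \<beta> :: "'k::field_char_0"
  assumes nz: "\<alpha> + \<beta> \<noteq> 0" "6 * \<alpha> + \<beta> \<noteq> 0" "16 * \<alpha> + \<beta> \<noteq> 0"
begin

lemma h_quotient:
  obtains br and \<pi> :: "(hgen, 'k) fa \<Rightarrow> (hgen, 'k) fa"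
  where "h_alg br \<alpha> \<beta> (\<pi> hA0) (\<pi> hA1) (\<pi> hY)" "lie_hom_on free_lie fa_br br \<pi>"
    "\<And>x. x \<in> free_lie \<Longrightarrow> \<pi> x = 0 \<longleftrightarrow> x \<in> lie_ideal (h_rels \<alpha> \<beta>)"
proof -
  obtain br and \<pi> :: "(hgen, 'k) fa \<Rightarrow> (hgen, 'k) fa" where h: "lie_alg br" "lie_hom_on free_lie fa_br br \<pi>"
    "\<And>x. x \<in> free_lie \<Longrightarrow> \<pi> x = 0 \<longleftrightarrow> x \<in> lie_ideal (h_rels \<alpha> \<beta>)"
    by (rule quotient_lie_alg[OF h_rels_free_lie]) (rule that)
  have "h_alg br \<alpha> \<beta> (\<pi> hA0) (\<pi> hA1) (\<pi> hY)"
    using h(3) h_rels_free_lie by (intro h_alg_of_hom[OF nz h(1,2)]) (auto intro: li_rel)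
  then show ?thesis using h(2,3) by (rule that)
qed

lemma pres_nilpotent_h_rels: "\<alpha> = 0 \<Longrightarrow> pres_nilpotent (h_rels \<alpha> \<beta>)"
  unfolding pres_nilpotent_def by (rule h_quotient, rule exI, rule lcs_3_zero)

lemma pres_dim_le_h_rels: "pres_dim_le (h_rels \<alpha> \<beta>) 6"
  by (rule h_quotient, rule dim_le_6)

text \<open>\<open>to_tgt\<close> kills the ideal, so its value on \<open>x\<close> is that on a
  normal form, where it is explicit.\<close>

lemma to_tgt_eq_hcomb:
  assumes "x \<in> free_lie"
  shows "\<exists>c0 c1 c2 c3 c4 c5. x - hcomb c0 c1 c2 c3 c4 c5 \<in> lie_ideal (h_rels \<alpha> \<beta>) \<and>
    to_tgt \<alpha> x = (mat2 (2 * \<alpha> * c3) (8 * \<alpha>\<^sup>2 * c5 - 2 * \<alpha> * c1) (c0 + 4 * \<alpha> * c4) (- 2 * \<alpha> * c3), vec3 c2 c0 c1)"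
proof -
  have "\<exists>c0 c1 c2 c3 c4 c5. x - hcomb c0 c1 c2 c3 c4 c5 \<in> lie_ideal (h_rels \<alpha> \<beta>)"
    by (rule h_quotient, rule eq_hcomb_mod[OF _ _ _ assms])
  then obtain c0 c1 c2 c3 c4 c5 where c: "x - hcomb c0 c1 c2 c3 c4 c5 \<in> lie_ideal (h_rels \<alpha> \<beta>)"
    by blast
  let ?y = "hcomb c0 c1 c2 c3 c4 c5"
  have "x - ?y \<in> free_lie" using c lie_ideal_subset[OF h_rels_free_lie] by blast
  from to_tgt_add[OF this hcomb_free_lie[of c0 c1 c2 c3 c4 c5]] have "to_tgt \<alpha> x = tgt_add (to_tgt \<alpha> (x - ?y)) (to_tgt \<alpha> ?y)"
    by simp
  also have "\<dots> = to_tgt \<alpha> ?y"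
    by (simp add: to_tgt_ideal[OF c] tgt_add_def)
  finally show ?thesis using c by (auto simp: to_tgt_hcomb intro!: exI)
qed

text \<open>The vector part determines c0, c1, c2, and then, as \<alpha> is nonzero, the matrix
  entries determine c3, c4, c5. This gives injectivity modulo the ideal and, solved for the
  coefficients, a preimage of any given pair.\<close>

lemma iso_to_tgt_h:
  assumes \<alpha>: "\<alpha> \<noteq> 0"
  shows "iso_to_tgt (h_rels \<alpha> \<beta>) (to_tgt \<alpha>)"
  unfolding iso_to_tgt_def
proof (intro conjI ballI allI)
  show "to_tgt \<alpha> ` free_lie = tgt_carrier"
  proof (intro subset_antisym subsetI)
    fix t assume "t \<in> to_tgt \<alpha> ` free_lie"
    then show "t \<in> tgt_carrier"
      using to_tgt_eq_hcomb by (fastforce simp: tgt_carrier_def mat2_trace)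
  next
    fix t :: "'k tgt" assume "t \<in> tgt_carrier"
    moreover obtain M v where t: "t = (M, v)" by (cases t)
    ultimately have tr: "M $ 2 $ 2 = - M $ 1 $ 1" by (simp add: tgt_carrier_def add_eq_0_iff)
    let ?y = "hcomb (v $ 2) (v $ 3) (v $ 1) (M $ 1 $ 1 / (2 * \<alpha>)) ((M $ 2 $ 1 - v $ 2) / (4 * \<alpha>))
      ((M $ 1 $ 2 + 2 * \<alpha> * v $ 3) / (8 * \<alpha>\<^sup>2))"
    have "to_tgt \<alpha> ?y = (M, v)"
      using \<alpha> by (subst mat2_cases[of M], subst vec3_cases[of v]) (simp add: to_tgt_hcomb mat2_eq_iff vec3_eq_iff tr)
    then show "t \<in> to_tgt \<alpha> ` free_lie" unfolding t using hcomb_free_lie by (metis imageI)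
  qed
next
  fix x :: "(hgen, 'k) fa" assume x: "x \<in> free_lie"
  show "to_tgt \<alpha> x = (0, 0) \<longleftrightarrow> x \<in> lie_ideal (h_rels \<alpha> \<beta>)"
  proof
    obtain c0 c1 c2 c3 c4 c5 where c: "x - hcomb c0 c1 c2 c3 c4 c5 \<in> lie_ideal (h_rels \<alpha> \<beta>)"
      and t: "to_tgt \<alpha> x = (mat2 (2 * \<alpha> * c3) (8 * \<alpha>\<^sup>2 * c5 - 2 * \<alpha> * c1) (c0 + 4 * \<alpha> * c4) (- 2 * \<alpha> * c3), vec3 c2 c0 c1)"
      using to_tgt_eq_hcomb[OF x] by blast
    assume "to_tgt \<alpha> x = (0, 0)"
    then have "c0 = 0" "c1 = 0" "c2 = 0" "c3 = 0" "c4 = 0" "c5 = 0"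
      using \<alpha> by (auto simp: t mat2_eqs(5) vec3_eqs(3) mat2_eq_iff vec3_eq_iff)
    then show "x \<in> lie_ideal (h_rels \<alpha> \<beta>)" using c by (simp add: hcomb_def)
  qed (rule to_tgt_ideal)
qed (simp_all add: fa_eqs to_tgt_add to_tgt_sc to_tgt_br)

lemma to_tgt_sl2_span:
  assumes \<alpha>: "\<alpha> \<noteq> 0"
  shows "to_tgt \<alpha> ` fa_span [fa_br hA0 hA1, fa_br hA0 (fa_br hA0 hA1), fa_br hA1 (fa_br hA0 hA1)] =
    {(M, 0) | M. M $ 1 $ 1 + M $ 2 $ 2 = 0}" (is "to_tgt \<alpha> ` ?S = ?T")
proof -
  have S: "?S = {hcomb 0 0 0 c d e | c d e. True}"
    by (simp add: fa_span_3 hcomb_def)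
  show ?thesis
  proof (intro subset_antisym subsetI)
    fix t assume "t \<in> to_tgt \<alpha> ` ?S"
    then show "t \<in> ?T"
      unfolding S by (auto simp: to_tgt_hcomb vec3_eqs mat2_trace)
  next
    fix t assume "t \<in> ?T"
    then obtain M where t: "t = (M, 0)" and "M $ 1 $ 1 + M $ 2 $ 2 = 0" by blast
    then have tr: "M $ 2 $ 2 = - M $ 1 $ 1" by (simp add: add_eq_0_iff)
    let ?y = "hcomb 0 0 0 (M $ 1 $ 1 / (2 * \<alpha>)) (M $ 2 $ 1 / (4 * \<alpha>)) (M $ 1 $ 2 / (8 * \<alpha>\<^sup>2))"
    have "to_tgt \<alpha> ?y = (M, 0)"
      using \<alpha> by (subst mat2_cases[of M]) (simp add: to_tgt_hcomb mat2_eq_iff vec3_eqs(3) tr)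
    moreover have "?y \<in> ?S" unfolding S by blast
    ultimately show "t \<in> to_tgt \<alpha> ` ?S" unfolding t by (metis imageI)
  qed
qed

text \<open>The matrices of [A0, [A0, A1]] and [A1, [A0, A1]] are 4\<alpha> and -4\<alpha> times
  those of A0 and A1, so the matrix parts of Z0 and Z1 cancel.\<close>

lemma to_tgt_abelian_span:
  assumes \<alpha>: "\<alpha> \<noteq> 0"
  shows "to_tgt \<alpha> ` fa_span [hY, fa_add (fa_smult (- 4 * \<alpha>) hA0) (fa_br hA0 (fa_br hA0 hA1)),
      fa_add (fa_smult (4 * \<alpha>) hA1) (fa_br hA1 (fa_br hA0 hA1))] = {(0, v) | v. True}" (is "to_tgt \<alpha> ` ?S = ?T")
proof -
  have S: "?S = {hcomb (- 4 * \<alpha> * d) (4 * \<alpha> * e) c 0 d e | c d e. True}"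
    by (simp add: fa_span_3 hcomb_def fa_eqs sc.scale_right_distrib algebra_simps)
  have t: "to_tgt \<alpha> (hcomb (- 4 * \<alpha> * d) (4 * \<alpha> * e) c 0 d e) = (0, vec3 c (- 4 * \<alpha> * d) (4 * \<alpha> * e))" for c d e
    by (simp add: to_tgt_hcomb mat2_eqs(5) mat2_eq_iff power2_eq_square)
  show ?thesis
  proof (intro subset_antisym subsetI)
    fix z assume "z \<in> to_tgt \<alpha> ` ?S"
    then show "z \<in> ?T" unfolding S using t by auto
  next
    fix z assume "z \<in> ?T"
    then obtain v where z: "z = (0, v)" by blast
    \<comment> \<open>The coefficients stay unsimplified so that \<open>t\<close> applies to
      \<open>?y\<close> literally.\<close>
    let ?y = "hcomb (- 4 * \<alpha> * (- v $ 2 / (4 * \<alpha>))) (4 * \<alpha> * (v $ 3 / (4 * \<alpha>))) (v $ 1) 0 (- v $ 2 / (4 * \<alpha>)) (v $ 3 / (4 * \<alpha>))"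
    have "to_tgt \<alpha> ?y = (0, v)"
      unfolding t using \<alpha> by (subst vec3_cases[of v]) (simp add: vec3_eq_iff)
    moreover have "?y \<in> ?S" unfolding S by blast
    ultimately show "z \<in> to_tgt \<alpha> ` ?S" unfolding z by (metis imageI)
  qed
qed

end

theorem theorem4p7:
  fixes \<alpha> \<beta> :: "'k::field_char_0" and a :: "nat \<Rightarrow> 'k"
  assumes K: "is_R_or_C TYPE('k)"
    and "\<alpha> + \<beta> \<noteq> 0" and "6 * \<alpha> + \<beta> \<noteq> 0" and "16 * \<alpha> + \<beta> \<noteq> 0"
  shows "pres_iso (WE_rels (F_eq \<alpha> \<beta>) a) (h_rels \<alpha> \<beta>)
    \<and> (\<alpha> \<noteq> 0 \<longrightarrow>
        (let E1 = fa_br hA0 hA1; E2 = fa_br hA0 (fa_br hA0 hA1); E3 = fa_br hA1 (fa_br hA0 hA1);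
             Z0 = fa_add (fa_smult (- 4 * \<alpha>) hA0) (fa_br hA0 (fa_br hA0 hA1));
             Z1 = fa_add (fa_smult (4 * \<alpha>) hA1) (fa_br hA1 (fa_br hA0 hA1))
         in \<exists>\<Phi>. iso_to_tgt (h_rels \<alpha> \<beta>) \<Phi>
              \<and> \<Phi> ` fa_span [E1, E2, E3] = {(M, 0) | M. M $ 1 $ 1 + M $ 2 $ 2 = 0}
              \<and> \<Phi> ` fa_span [hY, Z0, Z1] = {(0, v) | v. True}))
    \<and> (\<alpha> = 0 \<longrightarrow> pres_nilpotent (h_rels \<alpha> \<beta>) \<and> pres_dim_le (h_rels \<alpha> \<beta>) 6)"
proof -
  note nz = assms(2-4)
  have "pres_iso (WE_rels (F_eq \<alpha> \<beta>) a) (h_rels \<alpha> \<beta>)"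
    by (rule pres_iso_WE_h[OF nz])
  moreover have "pres_nilpotent (h_rels \<alpha> \<beta>)" if "\<alpha> = 0"
    by (rule pres_nilpotent_h_rels[OF nz that])
  moreover have "pres_dim_le (h_rels \<alpha> \<beta>) 6"
    by (rule pres_dim_le_h_rels[OF nz])
  ultimately show ?thesis
    unfolding Let_def
    using iso_to_tgt_h[OF nz] to_tgt_sl2_span[OF nz] to_tgt_abelian_span[OF nz] by blast
qed

end
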